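(* Let $A$ be a positive semi-definite intersection matrix (IM) with $\operatorname{corank}A\le 1$. Then the intersection matrix Lie algebra $\mathrm{IM}(A)$ is isomorphic to a Kac–Moody Lie algebra.
   Context: An intersection matrix (IM) is a symmetric integral matrix $A=(A_{ij})_{i,j\in I}$ ($I$ finite) with $A_{ii}=2$ for all $i$. $\operatorname{corank}A=|I|-\operatorname{rank}A$. Let $H$ be a $\mathbb Q$-vector space of dimension $|I|$ with basis $\Delta=\{\alpha_i\mid i\in I\}$ and symmetric bilinear form $(\alpha_i,\alpha_j)=A_{ij}$; put $\alpha^\vee=2\alpha/(\alpha,\alpha)$ (so $\alpha^\vee=\alpha$ for $\alpha\in\pm\Delta$), $\Gamma=\sum_i\mathbb Z\alpha_i$, and $\mathfrak h=H\otimes_{\mathbb Q}\mathbb C$ with the form extended bilinearly. Let $\widetilde{\mathfrak g}(A)$ be the complex Lie algebra generated by $\mathfrak h$ and $e_\alpha$, $\alpha\in\pm\Delta$, with defining relations: $[h,h']=0$ for $h,h'\in\mathfrak h$; $[h,e_\alpha]=(h,\alpha)e_\alpha$ for $h\in\mathfrak h$, $\alpha\in\pm\Delta$; $[e_\alpha,e_{-\alpha}]=-\alpha^\vee$ for $\alpha\in\pm\Delta$. It is $\Gamma$-graded, $\widetilde{\mathfrak g}(A)=\bigoplus_{\gamma\in\Gamma}\widetilde{\mathfrak g}_\gamma$, by $\deg e_\alpha=\alpha$, $\deg h=0$. Let $\mathfrak r$ be the ideal generated by all $\widetilde{\mathfrak g}_\gamma$ with $\gamma\in\Gamma$, $(\gamma,\gamma)>2$.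 Then $\mathrm{IM}(A):=\widetilde{\mathfrak g}(A)/\mathfrak r$. Here the Kac–Moody Lie algebra of a symmetric generalized Cartan matrix $B=(B_{ij})_{i,j\in I}$ (an IM with non-positive off-diagonal entries) is taken with Cartan subalgebra $\mathfrak h_B=H_B\otimes_{\mathbb Q}\mathbb C$, where $H_B$ is a $\mathbb Q$-vector space of dimension $|I|$ with basis $\Delta_B=\{\beta_i\mid i\in I\}$ and symmetric bilinear form $(\beta_i,\beta_j)=B_{ij}$ (extended bilinearly to $\mathfrak h_B$), and $\alpha^\vee=2\alpha/(\alpha,\alpha)$ for $\alpha\in\pm\Delta_B$. That is, it is the complex Lie algebra generated by $\mathfrak h_B$ and $e_\alpha$, $\alpha\in\pm\Delta_B$, with relations $[h,h']=0$ for $h,h'\in\mathfrak h_B$; $[h,e_\alpha]=(h,\alpha)e_\alpha$ for $h\in\mathfrak h_B$, $\alpha\in\pm\Delta_B$; $[e_\alpha,e_{-\alpha}]=-\alpha^\vee$ for $\alpha\in\pm\Delta_B$; $[e_\alpha,e_{-\beta}]=0$ for $\alpha\neq\beta$ in $\Delta_B$; and the Serre relations $(\mathrm{ad}\,e_{\pm\alpha})^{1-(\alpha^\vee,\beta)}e_{\pm\beta}=0$ for $\alpha\ne\beta$ in $\Delta_B$ (same sign throughout). (If $B$ is invertible this is the usual Kac–Moody algebra $\mathfrak g(B)$; if $B$ is degenerate it is the usual derived algebra of $\mathfrak g(B)$.) *)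

theory Defs
  imports "HOL-Algebra.Algebraic_Closure_Type" "HOL-Algebra.Module" "HOL-Algebra.AbelCoset"
    "HOL-Analysis.Analysis"
begin

section \<open>Complex Lie algebras\<close>

text \<open>The fields \<open>mult\<close> and \<open>one\<close>, inherited from the ring record, play no role (as for the
  modules of HOL-Algebra) and are left undefined in all constructions below.\<close>

record 'a lie_alg = "(complex, 'a) module" +
  lie_bracket :: "'a \<Rightarrow> 'a \<Rightarrow> 'a"

abbreviation complex_field :: "complex ring" where
  "complex_field \<equiv> ring_of_type_algebra"

text \<open>The locale of modules of HOL-Algebra is \<open>Module.module\<close>; the unqualified name may refer to
  the type-class based locale \<open>Modules.module\<close>.\<close>

locale lie_algebra = Module.module complex_field L for L :: "'a lie_alg" +
  assumes bracket_closed: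
      "x \<in> carrier L \<Longrightarrow> y \<in> carrier L \<Longrightarrow> lie_bracket L x y \<in> carrier L"
    and bracket_add_left:
      "x \<in> carrier L \<Longrightarrow> y \<in> carrier L \<Longrightarrow> z \<in> carrier L \<Longrightarrow>
       lie_bracket L (x \<oplus>\<^bsub>L\<^esub> y) z = lie_bracket L x z \<oplus>\<^bsub>L\<^esub> lie_bracket L y z"
    and bracket_add_right:
      "x \<in> carrier L \<Longrightarrow> y \<in> carrier L \<Longrightarrow> z \<in> carrier L \<Longrightarrow>
       lie_bracket L x (y \<oplus>\<^bsub>L\<^esub> z) = lie_bracket L x y \<oplus>\<^bsub>L\<^esub> lie_bracket L x z"
    and bracket_smult_left:
      "x \<in> carrier L \<Longrightarrow> y \<in> carrier L \<Longrightarrow>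
       lie_bracket L (c \<odot>\<^bsub>L\<^esub> x) y = c \<odot>\<^bsub>L\<^esub> lie_bracket L x y"
    and bracket_smult_right:
      "x \<in> carrier L \<Longrightarrow> y \<in> carrier L \<Longrightarrow>
       lie_bracket L x (c \<odot>\<^bsub>L\<^esub> y) = c \<odot>\<^bsub>L\<^esub> lie_bracket L x y"
    and bracket_self: "x \<in> carrier L \<Longrightarrow> lie_bracket L x x = \<zero>\<^bsub>L\<^esub>"
    and jacobi:
      "x \<in> carrier L \<Longrightarrow> y \<in> carrier L \<Longrightarrow> z \<in> carrier L \<Longrightarrow>
       lie_bracket L x (lie_bracket L y z) \<oplus>\<^bsub>L\<^esub>
         (lie_bracket L y (lie_bracket L z x) \<oplus>\<^bsub>L\<^esub> lie_bracket L z (lie_bracket L x y)) = \<zero>\<^bsub>L\<^esub>"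

definition lie_hom :: "'a lie_alg \<Rightarrow> 'b lie_alg \<Rightarrow> ('a \<Rightarrow> 'b) set" where
  "lie_hom L M = {f \<in> carrier L \<rightarrow> carrier M.
     (\<forall>x\<in>carrier L. \<forall>y\<in>carrier L. f (x \<oplus>\<^bsub>L\<^esub> y) = f x \<oplus>\<^bsub>M\<^esub> f y) \<and>
     (\<forall>c. \<forall>x\<in>carrier L. f (c \<odot>\<^bsub>L\<^esub> x) = c \<odot>\<^bsub>M\<^esub> f x) \<and>
     (\<forall>x\<in>carrier L. \<forall>y\<in>carrier L. f (lie_bracket L x y) = lie_bracket M (f x) (f y))}"

definition lie_isomorphic :: "'a lie_alg \<Rightarrow> 'b lie_alg \<Rightarrow> bool" where
  "lie_isomorphic L M \<longleftrightarrow> (\<exists>f\<in>lie_hom L M. bij_betw f (carrier L) (carrier M))"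

definition lie_ideal :: "'a set \<Rightarrow> 'a lie_alg \<Rightarrow> bool" where
  "lie_ideal J L \<longleftrightarrow> submodule J complex_field L \<and> J \<subseteq> carrier L \<and>
     (\<forall>x\<in>carrier L. \<forall>y\<in>J. lie_bracket L x y \<in> J)"

definition lie_ideal_generated :: "'a lie_alg \<Rightarrow> 'a set \<Rightarrow> 'a set" where
  "lie_ideal_generated L S = \<Inter>{J. lie_ideal J L \<and> S \<subseteq> J}"

definition lie_quotient :: "'a lie_alg \<Rightarrow> 'a set \<Rightarrow> 'a set lie_alg" where
  "lie_quotient L J =
    \<lparr>carrier = a_rcosets\<^bsub>L\<^esub> J, monoid.mult = undefined, one = undefined,
     zero = J, add = set_add L,
     module.smult = (\<lambda>c U. \<Union>x\<in>U. J +>\<^bsub>L\<^esub> (c \<odot>\<^bsub>L\<^esub> x)),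
     lie_bracket = (\<lambda>U V. \<Union>x\<in>U. \<Union>y\<in>V. J +>\<^bsub>L\<^esub> lie_bracket L x y)\<rparr>"


section \<open>Lie algebras given by generators and relations\<close>

datatype 'x lie_term =
    Gen 'x
  | Zero
  | Plus "'x lie_term" "'x lie_term"
  | Scale complex "'x lie_term"
  | Bracket "'x lie_term" "'x lie_term"

text \<open>A pair \<open>(s, t)\<close> in \<open>R\<close> stands for the defining relation \<open>s = t\<close>. The following is the least
  congruence on terms which contains \<open>R\<close> and modulo which the axioms of complex Lie algebras hold.\<close>

inductive lie_cong :: "('x lie_term \<times> 'x lie_term) set \<Rightarrow> 'x lie_term \<Rightarrow> 'x lie_term \<Rightarrow> bool"
  for R where
  rel: "(s, t) \<in> R \<Longrightarrow> lie_cong R s t"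
| refl: "lie_cong R t t"
| sym: "lie_cong R s t \<Longrightarrow> lie_cong R t s"
| trans: "lie_cong R s t \<Longrightarrow> lie_cong R t u \<Longrightarrow> lie_cong R s u"
| cong_plus: "lie_cong R s s' \<Longrightarrow> lie_cong R t t' \<Longrightarrow> lie_cong R (Plus s t) (Plus s' t')"
| cong_scale: "lie_cong R t t' \<Longrightarrow> lie_cong R (Scale c t) (Scale c t')"
| cong_bracket: "lie_cong R s s' \<Longrightarrow> lie_cong R t t' \<Longrightarrow> lie_cong R (Bracket s t) (Bracket s' t')"
| plus_assoc: "lie_cong R (Plus (Plus s t) u) (Plus s (Plus t u))"
| plus_comm: "lie_cong R (Plus s t) (Plus t s)"
| plus_zero: "lie_cong R (Plus Zero t) t"
| plus_inverse: "lie_cong R (Plus (Scale (- 1) t) t) Zero"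
| scale_plus: "lie_cong R (Scale c (Plus s t)) (Plus (Scale c s) (Scale c t))"
| plus_scale: "lie_cong R (Scale (c + d) t) (Plus (Scale c t) (Scale d t))"
| scale_scale: "lie_cong R (Scale (c * d) t) (Scale c (Scale d t))"
| scale_one: "lie_cong R (Scale 1 t) t"
| bracket_plus_left: "lie_cong R (Bracket (Plus s t) u) (Plus (Bracket s u) (Bracket t u))"
| bracket_plus_right: "lie_cong R (Bracket s (Plus t u)) (Plus (Bracket s t) (Bracket s u))"
| bracket_scale_left: "lie_cong R (Bracket (Scale c s) t) (Scale c (Bracket s t))"
| bracket_scale_right: "lie_cong R (Bracket s (Scale c t)) (Scale c (Bracket s t))"
| bracket_self: "lie_cong R (Bracket t t) Zero"
| jacobi: "lie_cong R (Plus (Bracket s (Bracket t u))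
             (Plus (Bracket t (Bracket u s)) (Bracket u (Bracket s t)))) Zero"

definition lie_class :: "('x lie_term \<times> 'x lie_term) set \<Rightarrow> 'x lie_term \<Rightarrow> 'x lie_term set" where
  "lie_class R t = {(s, s'). lie_cong R s s'} `` {t}"

definition presented_lie_algebra ::
    "('x lie_term \<times> 'x lie_term) set \<Rightarrow> 'x lie_term set lie_alg" where
  "presented_lie_algebra R =
    \<lparr>carrier = UNIV // {(s, t). lie_cong R s t}, monoid.mult = undefined, one = undefined,
     zero = lie_class R Zero,
     add = (\<lambda>U V. \<Union>s\<in>U. \<Union>t\<in>V. lie_class R (Plus s t)),
     module.smult = (\<lambda>c U. \<Union>t\<in>U. lie_class R (Scale c t)),
     lie_bracket = (\<lambda>U V. \<Union>s\<in>U. \<Union>t\<in>V. lie_class R (Bracket s t))\<rparr>"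

lemma equiv_lie_cong: "equiv UNIV {(s, t). lie_cong R s t}"
  by (rule equivI) (auto simp: refl_on_def sym_def trans_def intro: lie_cong.refl lie_cong.sym lie_cong.trans)

lemma lie_class_eq: "lie_class R s = lie_class R t \<longleftrightarrow> lie_cong R s t"
  using eq_equiv_class_iff[OF equiv_lie_cong, of s t R] by (auto simp: lie_class_def)

lemma mem_lie_class: "s \<in> lie_class R t \<longleftrightarrow> lie_cong R t s"
  by (simp add: lie_class_def)

lemma carrier_presented_lie_algebra: "carrier (presented_lie_algebra R) = range (lie_class R)"
  by (auto simp: presented_lie_algebra_def quotient_def lie_class_def)

lemma presented_lie_algebra_simps:
  "\<zero>\<^bsub>presented_lie_algebra R\<^esub> = lie_class R Zero"
  "lie_class R s \<oplus>\<^bsub>presented_lie_algebra R\<^esub> lie_class R t = lie_class R (Plus s t)"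
  "c \<odot>\<^bsub>presented_lie_algebra R\<^esub> lie_class R t = lie_class R (Scale c t)"
  "lie_bracket (presented_lie_algebra R) (lie_class R s) (lie_class R t) = lie_class R (Bracket s t)"
proof -
  have *: "(\<Union>x\<in>lie_class R s. g x) = g s" if "\<And>x. lie_cong R s x \<Longrightarrow> g x = g s"
    for s and g :: "'a lie_term \<Rightarrow> 'b set"
    using that lie_cong.refl[of R s] unfolding set_eq_iff UN_iff Bex_def mem_lie_class by metis
  have **: "(\<Union>x\<in>lie_class R s. \<Union>y\<in>lie_class R t. g x y) = g s t"
    if "\<And>x y. lie_cong R s x \<Longrightarrow> lie_cong R t y \<Longrightarrow> g x y = g s t"
    for g :: "'a lie_term \<Rightarrow> 'a lie_term \<Rightarrow> 'b set"
    using that lie_cong.refl[of R] unfolding set_eq_iff UN_iff Bex_def mem_lie_class by metis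
  show "\<zero>\<^bsub>presented_lie_algebra R\<^esub> = lie_class R Zero"
    by (simp add: presented_lie_algebra_def)
  show "c \<odot>\<^bsub>presented_lie_algebra R\<^esub> lie_class R t = lie_class R (Scale c t)"
    by (simp add: presented_lie_algebra_def, rule *) (metis lie_class_eq lie_cong.cong_scale)
  have "\<And>x y. lie_cong R s x \<Longrightarrow> lie_cong R t y \<Longrightarrow> lie_class R (Plus x y) = lie_class R (Plus s t)"
    by (metis lie_class_eq lie_cong.cong_plus)
  then show "lie_class R s \<oplus>\<^bsub>presented_lie_algebra R\<^esub> lie_class R t = lie_class R (Plus s t)"
    by (simp add: presented_lie_algebra_def **)
  have "\<And>x y. lie_cong R s x \<Longrightarrow> lie_cong R t y \<Longrightarrow> lie_class R (Bracket x y) = lie_class R (Bracket s t)"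
    by (metis lie_class_eq lie_cong.cong_bracket)
  then show "lie_bracket (presented_lie_algebra R) (lie_class R s) (lie_class R t) = lie_class R (Bracket s t)"
    by (simp add: presented_lie_algebra_def **)
qed

lemma lie_algebra_presented: "lie_algebra (presented_lie_algebra R)"
proof -
  let ?L = "presented_lie_algebra R"
  note S = presented_lie_algebra_simps lie_class_eq carrier_presented_lie_algebra rangeI
    lie_cong.plus_assoc lie_cong.plus_comm lie_cong.plus_zero lie_cong.plus_inverse
    lie_cong.scale_plus lie_cong.plus_scale lie_cong.scale_scale lie_cong.scale_one
    lie_cong.bracket_plus_left lie_cong.bracket_plus_right lie_cong.bracket_scale_left
    lie_cong.bracket_scale_right lie_cong.bracket_self lie_cong.jacobi
  have c: "\<And>x. x \<in> carrier ?L \<Longrightarrow> \<exists>s. x = lie_class R s" by (auto simp: carrier_presented_lie_algebra)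
  have ag: "abelian_group ?L"
  proof (rule abelian_groupI)
    fix x assume "x \<in> carrier ?L"
    then obtain s where "x = lie_class R s" using c by blast
    then show "\<exists>y\<in>carrier ?L. y \<oplus>\<^bsub>?L\<^esub> x = \<zero>\<^bsub>?L\<^esub>"
      by (intro bexI[of _ "lie_class R (Scale (-1) s)"]) (simp_all add: S)
  qed ((simp add: S; fail) | ((drule c)+, (elim exE)?, simp add: S))+
  have m: "Module.module complex_field ?L"
    by (rule Module.moduleI[OF cring_from_type_algebra ag])
       ((drule c)+, (elim exE)?, simp add: S ring_of_type_algebra_def)+
  show ?thesis
    by (intro lie_algebra.intro[OF m] lie_algebra_axioms.intro) ((drule c)+, (elim exE)?, simp add: S)+
qed


section \<open>Intersection matrices\<close>

definition intersection_matrix :: "int^'n^'n \<Rightarrow> bool" where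
  "intersection_matrix A \<longleftrightarrow> transpose A = A \<and> (\<forall>i. A $ i $ i = 2)"

definition symmetric_generalized_cartan_matrix :: "int^'n^'n \<Rightarrow> bool" where
  "symmetric_generalized_cartan_matrix B \<longleftrightarrow>
     intersection_matrix B \<and> (\<forall>i j. i \<noteq> j \<longrightarrow> B $ i $ j \<le> 0)"

definition corank :: "int^'n^'n \<Rightarrow> nat" where
  "corank A = CARD('n) - rank (map_matrix rat_of_int A)"

text \<open>The bilinear form on \<open>\<Gamma> = int^'n\<close>, \<open>H = rat^'n\<close>, \<open>H \<otimes> \<real> = real^'n\<close> and
  \<open>\<hh> = H \<otimes> \<complex> = complex^'n\<close>, all written in coordinates with respect to the basis
  \<open>\<Delta>\<close> of the simple roots.\<close>

definition form :: "int^'n^'n \<Rightarrow> 'k::comm_ring_1^'n \<Rightarrow> 'k^'n \<Rightarrow> 'k" where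
  "form A x y = (\<Sum>i\<in>UNIV. \<Sum>j\<in>UNIV. x $ i * of_int (A $ i $ j) * y $ j)"

definition positive_semidefinite :: "int^'n^'n \<Rightarrow> bool" where
  "positive_semidefinite A \<longleftrightarrow> (\<forall>x::real^'n. 0 \<le> form A x x)"

text \<open>The set \<open>\<plusminus>\<Delta>\<close>: \<open>Pos i\<close> stands for \<open>\<alpha>\<^sub>i\<close> and \<open>Neg i\<close> for \<open>-\<alpha>\<^sub>i\<close>.\<close>

datatype 'n signed_simple = Pos 'n | Neg 'n

fun opposite :: "'n signed_simple \<Rightarrow> 'n signed_simple" where
  "opposite (Pos i) = Neg i"
| "opposite (Neg i) = Pos i"

fun root_of :: "'n signed_simple \<Rightarrow> 'k::comm_ring_1^'n" where
  "root_of (Pos i) = axis i 1"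
| "root_of (Neg i) = - axis i 1"

definition coroot :: "int^'n^'n \<Rightarrow> 'n signed_simple \<Rightarrow> complex^'n" where
  "coroot A \<alpha> = (2 / form A (root_of \<alpha>) (root_of \<alpha>)) *s root_of \<alpha>"


section \<open>Intersection matrix Lie algebras\<close>

datatype 'n generator = Cartan "complex^'n" | RootVector "'n signed_simple"

abbreviation cartan :: "complex^'n \<Rightarrow> 'n generator lie_term" where
  "cartan h \<equiv> Gen (Cartan h)"

abbreviation root_vec :: "'n::finite signed_simple \<Rightarrow> 'n generator lie_term" where
  "root_vec \<alpha> \<equiv> Gen (RootVector \<alpha>)"

text \<open>The first two sets express that \<open>\<hh>\<close> enters the presentation as a vector space.\<close>

definition tilde_relations ::
    "int^'n^'n \<Rightarrow> ('n generator lie_term \<times> 'n generator lie_term) set" where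
  "tilde_relations A =
     {(cartan (h + h'), Plus (cartan h) (cartan h')) | h h'. True} \<union>
     {(cartan (c *s h), Scale c (cartan h)) | c h. True} \<union>
     {(Bracket (cartan h) (cartan h'), Zero) | h h'. True} \<union>
     {(Bracket (cartan h) (root_vec \<alpha>), Scale (form A h (root_of \<alpha>)) (root_vec \<alpha>)) | h \<alpha>. True} \<union>
     {(Bracket (root_vec \<alpha>) (root_vec (opposite \<alpha>)), cartan (- coroot A \<alpha>)) | \<alpha>. True}"

definition tilde_algebra :: "int^'n^'n \<Rightarrow> 'n generator lie_term set lie_alg" where
  "tilde_algebra A = presented_lie_algebra (tilde_relations A)"

text \<open>\<open>homogeneous A \<gamma> x\<close> means that \<open>x\<close> lies in the component of degree \<open>\<gamma>\<close>: these components are the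
  least family of subspaces that contains the generators in the prescribed degrees and is
  compatible with the bracket. The degrees live in the abstract lattice \<open>\<Gamma>\<close> and not in the
  dual of \<open>\<hh>\<close>, which makes a difference when the form is degenerate.\<close>

inductive homogeneous :: "int^'n^'n \<Rightarrow> int^'n \<Rightarrow> 'n generator lie_term set \<Rightarrow> bool"
  for A where
  cartan: "homogeneous A 0 (lie_class (tilde_relations A) (cartan h))"
| root_vector: "homogeneous A (root_of \<alpha>) (lie_class (tilde_relations A) (root_vec \<alpha>))"
| zero: "homogeneous A \<gamma> \<zero>\<^bsub>tilde_algebra A\<^esub>"
| add: "homogeneous A \<gamma> x \<Longrightarrow> homogeneous A \<gamma> y \<Longrightarrow> homogeneous A \<gamma> (x \<oplus>\<^bsub>tilde_algebra A\<^esub> y)"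
| smult: "homogeneous A \<gamma> x \<Longrightarrow> homogeneous A \<gamma> (c \<odot>\<^bsub>tilde_algebra A\<^esub> x)"
| bracket: "homogeneous A \<gamma> x \<Longrightarrow> homogeneous A \<delta> y \<Longrightarrow>
    homogeneous A (\<gamma> + \<delta>) (lie_bracket (tilde_algebra A) x y)"

definition IM_ideal :: "int^'n^'n \<Rightarrow> 'n generator lie_term set set" where
  "IM_ideal A = lie_ideal_generated (tilde_algebra A) {x. \<exists>\<gamma>. form A \<gamma> \<gamma> > 2 \<and> homogeneous A \<gamma> x}"

definition IM :: "int^'n^'n \<Rightarrow> 'n generator lie_term set set lie_alg" where
  "IM A = lie_quotient (tilde_algebra A) (IM_ideal A)"


section \<open>Kac-Moody Lie algebras\<close>

text \<open>The exponent \<open>1 - (\<alpha>\<^sub>i\<^sup>\<or>, \<alpha>\<^sub>j)\<close> in the Serre relations is \<open>1 - B\<^sub>i\<^sub>j\<close> because \<open>B\<^sub>i\<^sub>i = 2\<close>.\<close>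

definition kac_moody_relations ::
    "int^'n^'n \<Rightarrow> ('n generator lie_term \<times> 'n generator lie_term) set" where
  "kac_moody_relations B = tilde_relations B \<union>
     {(Bracket (root_vec (Pos i)) (root_vec (Neg j)), Zero) | i j. i \<noteq> j} \<union>
     {((Bracket (root_vec (Pos i)) ^^ nat (1 - B $ i $ j)) (root_vec (Pos j)), Zero) | i j. i \<noteq> j} \<union>
     {((Bracket (root_vec (Neg i)) ^^ nat (1 - B $ i $ j)) (root_vec (Neg j)), Zero) | i j. i \<noteq> j}"

definition kac_moody_algebra :: "int^'n^'n \<Rightarrow> 'n generator lie_term set lie_alg" where
  "kac_moody_algebra B = presented_lie_algebra (kac_moody_relations B)"

end

theory Submission
  imports Defs
begin

text \<open>The algebra \<open>IM(A)\<close> depends only on the lattice \<open>\<Gamma>\<close> with its form and on the basis \<open>\<Delta>\<close>, and the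
  basis may be changed in two ways without changing the algebra. The first is to replace simple
  roots by their negatives, which merely exchanges generators. The second is a reflection: if
  \<open>(\<alpha>\<^sub>i, \<alpha>\<^sub>j) = 1\<close>, then \<open>\<alpha>\<^sub>j\<close> may be replaced by \<open>\<alpha>\<^sub>j - \<alpha>\<^sub>i\<close>, with the root vectors
  \<open>[e\<^sub>j, e\<^sub>-\<^sub>i]\<close> and \<open>[e\<^sub>-\<^sub>j, e\<^sub>i]\<close> (lemma \<open>IM_isomorphic_shear\<close>). All defining relations in the new basis
  follow from the grading, apart from the bracket of these two vectors. This bracket and the fact
  that the change of basis can be undone are computed from the vanishing of \<open>[e\<^sub>j, e\<^sub>i]\<close>, whose degree has
  norm \<open>6\<close>.

  If \<open>A\<close> is positive semidefinite of corank at most one, then such changes of basis lead to a matrix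
  without positive entries off the diagonal (lemma \<open>admissible_isomorphic_kac_moody\<close>). Let the radical
  of \<open>\<Gamma>\<close> be generated by \<open>d\<close>, where \<open>d = 0\<close> in the definite case. After sign changes, \<open>d\<close> has
  nonnegative coordinates. As long as there is a positive entry, it is \<open>1\<close>, and the corresponding
  reflection can be chosen such that it either increases the sum of the coordinates of \<open>d\<close>, or keeps
  \<open>d\<close> and increases the number of vectors of norm \<open>2\<close> with nonnegative coordinates that are supported
  outside the support of \<open>d\<close>; this number is finite. Only finitely many matrices occur, because
  their entries lie between \<open>-2\<close> and \<open>2\<close>, and \<open>d\<close> is determined by the matrix. Hence the process
  ends.

  Finally, let \<open>B\<close> be a symmetric generalized Cartan matrix. Then \<open>IM(B)\<close> and the Kac-Moody algebra of
  \<open>B\<close> have equivalent relations (lemma \<open>presented_IM_eq_kac_moody\<close>). The Serre relations and the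
  relations \<open>[e\<^sub>i, e\<^sub>-\<^sub>j] = 0\<close> are homogeneous of degrees with norm larger than \<open>2\<close>. Conversely, all
  roots of the Kac-Moody algebra have norm at most \<open>2\<close>, because the triangular decomposition puts
  them into the positive or the negative cone and because the Serre relations make the set of roots
  stable under reflections.

  All of this is carried out on terms in the generators: \<open>IM(A)\<close> is itself presented by generators and
  relations (lemma \<open>IM_isomorphic_presented\<close>), so that isomorphisms are given by substitutions.\<close>

section \<open>Brackets and representations of \<open>\<ss>\<ll>\<^sub>2\<close> in complex Lie algebras\<close>

context lie_algebra
begin

lemma smult_closed_complex [simp, intro]: "x \<in> carrier L \<Longrightarrow> c \<odot>\<^bsub>L\<^esub> x \<in> carrier L"
  using smult_closed by (simp add: ring_of_type_algebra_def)

lemma smult_add_scalar: "x \<in> carrier L \<Longrightarrow> (c + d) \<odot>\<^bsub>L\<^esub> x = c \<odot>\<^bsub>L\<^esub> x \<oplus>\<^bsub>L\<^esub> d \<odot>\<^bsub>L\<^esub> x"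
  using smult_l_distr[of c d x] by (simp add: ring_of_type_algebra_def)

lemma smult_add_vector:
  "x \<in> carrier L \<Longrightarrow> y \<in> carrier L \<Longrightarrow> c \<odot>\<^bsub>L\<^esub> (x \<oplus>\<^bsub>L\<^esub> y) = c \<odot>\<^bsub>L\<^esub> x \<oplus>\<^bsub>L\<^esub> c \<odot>\<^bsub>L\<^esub> y"
  using smult_r_distr[of c x y] by (simp add: ring_of_type_algebra_def)

lemma smult_smult: "x \<in> carrier L \<Longrightarrow> c \<odot>\<^bsub>L\<^esub> (d \<odot>\<^bsub>L\<^esub> x) = (c * d) \<odot>\<^bsub>L\<^esub> x"
  using smult_assoc1[of c d x] by (simp add: ring_of_type_algebra_def)

lemma smult_one_complex [simp]: "x \<in> carrier L \<Longrightarrow> 1 \<odot>\<^bsub>L\<^esub> x = x"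
  using smult_one[of x] by (simp add: ring_of_type_algebra_def)

lemma smult_zero_scalar [simp]: "x \<in> carrier L \<Longrightarrow> 0 \<odot>\<^bsub>L\<^esub> x = \<zero>\<^bsub>L\<^esub>"
  using smult_l_null[of x] by (simp add: ring_of_type_algebra_def)

lemma smult_zero_vector [simp]: "c \<odot>\<^bsub>L\<^esub> \<zero>\<^bsub>L\<^esub> = \<zero>\<^bsub>L\<^esub>"
  using smult_r_null[of c] by (simp add: ring_of_type_algebra_def)

lemma add_smult_minus_one [simp]:
  assumes "x \<in> carrier L"
  shows "x \<oplus>\<^bsub>L\<^esub> (- 1) \<odot>\<^bsub>L\<^esub> x = \<zero>\<^bsub>L\<^esub>" "(- 1) \<odot>\<^bsub>L\<^esub> x \<oplus>\<^bsub>L\<^esub> x = \<zero>\<^bsub>L\<^esub>"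
  using smult_add_scalar[OF assms, of 1 "-1"] smult_add_scalar[OF assms, of "-1" 1] assms
  by simp_all

lemma minus_eq_smult: "x \<in> carrier L \<Longrightarrow> \<ominus>\<^bsub>L\<^esub> x = (- 1) \<odot>\<^bsub>L\<^esub> x"
  by (rule minus_equality) simp_all

lemma smult_eq_zero:
  assumes "c \<odot>\<^bsub>L\<^esub> x = \<zero>\<^bsub>L\<^esub>" "c \<noteq> 0" "x \<in> carrier L"
  shows "x = \<zero>\<^bsub>L\<^esub>"
  using smult_smult[of x "inverse c" c] assms by simp

lemma bracket_zero [simp]:
  assumes "x \<in> carrier L"
  shows "lie_bracket L x \<zero>\<^bsub>L\<^esub> = \<zero>\<^bsub>L\<^esub>" "lie_bracket L \<zero>\<^bsub>L\<^esub> x = \<zero>\<^bsub>L\<^esub>"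
  using bracket_smult_right[OF assms zero_closed, of 0] bracket_smult_left[OF zero_closed assms, of 0]
  by (simp_all add: bracket_closed assms)

lemma bracket_anti:
  assumes [simp]: "x \<in> carrier L" "y \<in> carrier L"
  shows "lie_bracket L x y = (- 1) \<odot>\<^bsub>L\<^esub> lie_bracket L y x"
proof -
  note [simp] = bracket_closed
  have "\<zero>\<^bsub>L\<^esub> = lie_bracket L (x \<oplus>\<^bsub>L\<^esub> y) (x \<oplus>\<^bsub>L\<^esub> y)"
    by (simp add: bracket_self)
  also have "\<dots> = lie_bracket L x y \<oplus>\<^bsub>L\<^esub> lie_bracket L y x"
    by (subst bracket_add_left, simp_all, subst (1 2) bracket_add_right, simp_all)
       (simp add: bracket_self)
  finally show ?thesis
    using minus_equality[of "lie_bracket L x y" "lie_bracket L y x"] by (simp add: minus_eq_smult)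
qed

lemma bracket_derivation:
  assumes [simp]: "x \<in> carrier L" "y \<in> carrier L" "z \<in> carrier L"
  shows "lie_bracket L x (lie_bracket L y z) =
    lie_bracket L (lie_bracket L x y) z \<oplus>\<^bsub>L\<^esub> lie_bracket L y (lie_bracket L x z)"
proof -
  note [simp] = bracket_closed
  let ?a = "lie_bracket L x (lie_bracket L y z)"
  let ?b = "lie_bracket L y (lie_bracket L x z)"
  let ?c = "lie_bracket L (lie_bracket L x y) z"
  have b: "lie_bracket L y (lie_bracket L z x) = \<ominus>\<^bsub>L\<^esub> ?b"
    by (subst bracket_anti[of z x]) (simp_all add: bracket_smult_right minus_eq_smult)
  have c: "lie_bracket L z (lie_bracket L x y) = \<ominus>\<^bsub>L\<^esub> ?c"
    by (subst bracket_anti[of z]) (simp_all add: minus_eq_smult)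
  have "?a \<oplus>\<^bsub>L\<^esub> (\<ominus>\<^bsub>L\<^esub> ?b \<oplus>\<^bsub>L\<^esub> \<ominus>\<^bsub>L\<^esub> ?c) = \<zero>\<^bsub>L\<^esub>"
    using jacobi[of x y z] unfolding b c by simp
  then have "?a \<oplus>\<^bsub>L\<^esub> \<ominus>\<^bsub>L\<^esub> (?c \<oplus>\<^bsub>L\<^esub> ?b) = \<zero>\<^bsub>L\<^esub>"
    by (simp add: minus_add a_comm)
  then have "\<ominus>\<^bsub>L\<^esub> (\<ominus>\<^bsub>L\<^esub> (?c \<oplus>\<^bsub>L\<^esub> ?b)) = ?a"
    by (intro minus_equality) simp_all
  then show ?thesis
    by (metis minus_minus a_closed bracket_closed assms)
qed

lemma bracket_bracket_left:
  assumes [simp]: "x \<in> carrier L" "y \<in> carrier L" "z \<in> carrier L"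
  shows "lie_bracket L (lie_bracket L x y) z =
    lie_bracket L x (lie_bracket L y z) \<oplus>\<^bsub>L\<^esub> (- 1) \<odot>\<^bsub>L\<^esub> lie_bracket L y (lie_bracket L x z)"
  by (subst bracket_derivation) (simp_all add: bracket_closed a_assoc)


lemma ad_power_closed [simp]:
  "x \<in> carrier L \<Longrightarrow> y \<in> carrier L \<Longrightarrow> (lie_bracket L x ^^ n) y \<in> carrier L"
  by (induction n) (simp_all add: bracket_closed)

lemma ad_power_zero [simp]: "x \<in> carrier L \<Longrightarrow> (lie_bracket L x ^^ n) \<zero>\<^bsub>L\<^esub> = \<zero>\<^bsub>L\<^esub>"
  by (induction n) simp_all

lemma ad_power_zero_mono:
  assumes "(lie_bracket L x ^^ m) y = \<zero>\<^bsub>L\<^esub>" "m \<le> n" "x \<in> carrier L"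
  shows "(lie_bracket L x ^^ n) y = \<zero>\<^bsub>L\<^esub>"
proof -
  have "(lie_bracket L x ^^ (n - m + m)) y = \<zero>\<^bsub>L\<^esub>"
    unfolding funpow_add using assms by simp
  then show ?thesis using assms by simp
qed

lemma ad_power_add:
  "x \<in> carrier L \<Longrightarrow> y \<in> carrier L \<Longrightarrow> z \<in> carrier L \<Longrightarrow>
   (lie_bracket L x ^^ n) (y \<oplus>\<^bsub>L\<^esub> z) = (lie_bracket L x ^^ n) y \<oplus>\<^bsub>L\<^esub> (lie_bracket L x ^^ n) z"
  by (induction n) (simp_all add: bracket_add_right)

lemma ad_power_smult:
  "x \<in> carrier L \<Longrightarrow> y \<in> carrier L \<Longrightarrow>
   (lie_bracket L x ^^ n) (c \<odot>\<^bsub>L\<^esub> y) = c \<odot>\<^bsub>L\<^esub> (lie_bracket L x ^^ n) y"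
  by (induction n) (simp_all add: bracket_smult_right)

text \<open>By the Leibniz rule, every further bracket with \<open>x\<close> falls on one of the two factors.\<close>

lemma ad_nilpotent_bracket:
  assumes "x \<in> carrier L" "y \<in> carrier L" "z \<in> carrier L"
    and "(lie_bracket L x ^^ m) y = \<zero>\<^bsub>L\<^esub>" "(lie_bracket L x ^^ n) z = \<zero>\<^bsub>L\<^esub>"
  shows "(lie_bracket L x ^^ (m + n)) (lie_bracket L y z) = \<zero>\<^bsub>L\<^esub>"
  using assms
proof (induction "m + n" arbitrary: m n y z)
  case 0
  then show ?case by simp
next
  case (Suc k)
  note [simp] = bracket_closed Suc.prems(1-3)
  show ?case
  proof (cases "m = 0 \<or> n = 0")
    case True
    then have "y = \<zero>\<^bsub>L\<^esub> \<or> z = \<zero>\<^bsub>L\<^esub>" using Suc.prems by auto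
    then show ?thesis by auto
  next
    case False
    then obtain m' n' where mn: "m = Suc m'" "n = Suc n'" by (meson not0_implies_Suc)
    have "(lie_bracket L x ^^ (m' + n)) (lie_bracket L (lie_bracket L x y) z) = \<zero>\<^bsub>L\<^esub>"
      using Suc.prems Suc.hyps(2) mn by (intro Suc.hyps(1)) (simp_all add: funpow_swap1)
    moreover have "(lie_bracket L x ^^ (m + n')) (lie_bracket L y (lie_bracket L x z)) = \<zero>\<^bsub>L\<^esub>"
      using Suc.prems Suc.hyps(2) mn by (intro Suc.hyps(1)) (simp_all add: funpow_swap1)
    moreover have "m + n = Suc (m' + n)" "m + n' = m' + n" using mn by simp_all
    ultimately show ?thesis
      by (simp add: funpow_Suc_right bracket_derivation[of x y z] ad_power_add del: funpow.simps)
  qed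
qed

lemma weight_ad_power:
  assumes [simp]: "h \<in> carrier L" "f \<in> carrier L" "y \<in> carrier L"
    and hf: "lie_bracket L h f = (- 2) \<odot>\<^bsub>L\<^esub> f" and hy: "lie_bracket L h y = w \<odot>\<^bsub>L\<^esub> y"
  shows "lie_bracket L h ((lie_bracket L f ^^ n) y) = (w - 2 * of_nat n) \<odot>\<^bsub>L\<^esub> (lie_bracket L f ^^ n) y"
proof (induction n)
  case 0
  then show ?case by (simp add: hy)
next
  case (Suc n)
  let ?z = "(lie_bracket L f ^^ n) y"
  have "lie_bracket L h (lie_bracket L f ?z) =
      (- 2) \<odot>\<^bsub>L\<^esub> lie_bracket L f ?z \<oplus>\<^bsub>L\<^esub> (w - 2 * of_nat n) \<odot>\<^bsub>L\<^esub> lie_bracket L f ?z"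
    by (simp add: bracket_derivation[of h f ?z] hf Suc bracket_smult_left bracket_smult_right)
  also have "\<dots> = (w - 2 * of_nat (Suc n)) \<odot>\<^bsub>L\<^esub> lie_bracket L f ?z"
    by (subst smult_add_scalar[symmetric]) (simp_all add: bracket_closed algebra_simps)
  finally show ?case by simp
qed

text \<open>The sign in \<open>[e, f] = -h\<close> is that of the relation \<open>[e\<^sub>\<alpha>, e\<^sub>-\<^sub>\<alpha>] = -\<alpha>\<^sup>\<or>\<close>: it is \<open>e\<close>, \<open>-f\<close> and \<open>h\<close>
  that form an \<open>\<ss>\<ll>\<^sub>2\<close>-triple, acting through the adjoint representation.\<close>

lemma sl2_commutator:
  assumes [simp]: "e \<in> carrier L" "h \<in> carrier L" "f \<in> carrier L" "y \<in> carrier L"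
    and hf: "lie_bracket L h f = (- 2) \<odot>\<^bsub>L\<^esub> f" and hy: "lie_bracket L h y = w \<odot>\<^bsub>L\<^esub> y"
    and ef: "lie_bracket L e f = (- 1) \<odot>\<^bsub>L\<^esub> h"
  shows "lie_bracket L e ((lie_bracket L f ^^ Suc n) y) = (lie_bracket L f ^^ Suc n) (lie_bracket L e y)
    \<oplus>\<^bsub>L\<^esub> (- of_nat (Suc n) * (w - of_nat n)) \<odot>\<^bsub>L\<^esub> (lie_bracket L f ^^ n) y"
proof (induction n)
  case 0
  show ?case
    by (simp add: bracket_derivation[of e f y] ef hy bracket_smult_left smult_smult a_comm bracket_closed)
next
  case (Suc n)
  note [simp] = bracket_closed
  let ?z = "(lie_bracket L f ^^ n) y" and ?c = "- of_nat (Suc n) * (w - of_nat n)"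
  let ?w = "w - 2 * of_nat (Suc n)"
  let ?u = "(lie_bracket L f ^^ Suc (Suc n)) (lie_bracket L e y)"
  have "lie_bracket L e ((lie_bracket L f ^^ Suc (Suc n)) y) =
      (- 1) \<odot>\<^bsub>L\<^esub> lie_bracket L h ((lie_bracket L f ^^ Suc n) y) \<oplus>\<^bsub>L\<^esub>
      lie_bracket L f (lie_bracket L e ((lie_bracket L f ^^ Suc n) y))"
    by (simp add: bracket_derivation[of e f "lie_bracket L f ?z"] ef bracket_smult_left)
  also have "lie_bracket L f (lie_bracket L e ((lie_bracket L f ^^ Suc n) y)) =
      ?u \<oplus>\<^bsub>L\<^esub> ?c \<odot>\<^bsub>L\<^esub> (lie_bracket L f ^^ Suc n) y"
    unfolding Suc by (simp add: bracket_add_right bracket_smult_right)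
  also have "lie_bracket L h ((lie_bracket L f ^^ Suc n) y) = ?w \<odot>\<^bsub>L\<^esub> (lie_bracket L f ^^ Suc n) y"
    using weight_ad_power[OF assms(2-4) hf hy, of "Suc n"] .
  also have "(- 1) \<odot>\<^bsub>L\<^esub> (?w \<odot>\<^bsub>L\<^esub> (lie_bracket L f ^^ Suc n) y) \<oplus>\<^bsub>L\<^esub>
      (?u \<oplus>\<^bsub>L\<^esub> ?c \<odot>\<^bsub>L\<^esub> (lie_bracket L f ^^ Suc n) y) =
      ?u \<oplus>\<^bsub>L\<^esub> ((- ?w) \<odot>\<^bsub>L\<^esub> (lie_bracket L f ^^ Suc n) y \<oplus>\<^bsub>L\<^esub> ?c \<odot>\<^bsub>L\<^esub> (lie_bracket L f ^^ Suc n) y)"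
    by (simp add: smult_smult a_lcomm)
  also have "(- ?w) \<odot>\<^bsub>L\<^esub> (lie_bracket L f ^^ Suc n) y \<oplus>\<^bsub>L\<^esub> ?c \<odot>\<^bsub>L\<^esub> (lie_bracket L f ^^ Suc n) y =
      (- ?w + ?c) \<odot>\<^bsub>L\<^esub> (lie_bracket L f ^^ Suc n) y"
    by (rule smult_add_scalar[symmetric]) simp
  also have "- ?w + ?c = - of_nat (Suc (Suc n)) * (w - of_nat (Suc n))"
    by (simp add: algebra_simps)
  finally show ?case .
qed

text \<open>The vector \<open>[e, y]\<close> has weight \<open>w + 2\<close> and is killed by the \<open>n + 1\<close>st power of \<open>ad f\<close>, so that
  induction on \<open>k\<close> reduces to the case \<open>[e, y] = 0\<close> of a highest weight vector. For such a vector
  the scalar in the commutator formula does not vanish below the power \<open>w + 1\<close> of \<open>ad f\<close>.\<close>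

lemma sl2_lowering_injective:
  assumes L: "e \<in> carrier L" "h \<in> carrier L" "f \<in> carrier L"
    and rel: "lie_bracket L h e = 2 \<odot>\<^bsub>L\<^esub> e" "lie_bracket L h f = (- 2) \<odot>\<^bsub>L\<^esub> f"
      "lie_bracket L e f = (- 1) \<odot>\<^bsub>L\<^esub> h"
    and y: "y \<in> carrier L" "lie_bracket L h y = of_nat w \<odot>\<^bsub>L\<^esub> y"
    and nil: "(lie_bracket L e ^^ k) y = \<zero>\<^bsub>L\<^esub>" "(lie_bracket L f ^^ n) y = \<zero>\<^bsub>L\<^esub>" "n \<le> w"
  shows "y = \<zero>\<^bsub>L\<^esub>"
  using y nil
proof (induction k arbitrary: y w n)
  case 0
  then show ?case by simp
next
  case (Suc k)
  note [simp] = L bracket_closed Suc.prems(1)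
  note com = sl2_commutator[OF L Suc.prems(1) rel(2) Suc.prems(2) rel(3)]
  have ey: "lie_bracket L e y = \<zero>\<^bsub>L\<^esub>"
  proof (rule Suc.IH[of _ "w + 2" "Suc n"])
    have "lie_bracket L h (lie_bracket L e y) =
        2 \<odot>\<^bsub>L\<^esub> lie_bracket L e y \<oplus>\<^bsub>L\<^esub> of_nat w \<odot>\<^bsub>L\<^esub> lie_bracket L e y"
      by (simp add: bracket_derivation[of h e y] rel Suc.prems bracket_smult_left bracket_smult_right)
    then show "lie_bracket L h (lie_bracket L e y) = of_nat (w + 2) \<odot>\<^bsub>L\<^esub> lie_bracket L e y"
      by (simp add: smult_add_scalar[symmetric] add.commute)
    show "(lie_bracket L e ^^ k) (lie_bracket L e y) = \<zero>\<^bsub>L\<^esub>"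
      using Suc.prems(3) by (simp add: funpow_swap1)
    show "(lie_bracket L f ^^ Suc n) (lie_bracket L e y) = \<zero>\<^bsub>L\<^esub>"
      using com[of n] Suc.prems(4) by (simp del: of_nat_Suc)
  qed (use Suc.prems in simp_all)
  have "(lie_bracket L f ^^ n) y = \<zero>\<^bsub>L\<^esub> \<Longrightarrow> n \<le> w \<Longrightarrow> y = \<zero>\<^bsub>L\<^esub>" for n
  proof (induction n)
    case (Suc n)
    have "(- of_nat (Suc n) * (of_nat w - of_nat n)) \<odot>\<^bsub>L\<^esub> (lie_bracket L f ^^ n) y = \<zero>\<^bsub>L\<^esub>"
      using com[of n] Suc.prems(1) ad_power_zero[OF L(3), of "Suc n"]
      by (simp add: ey del: of_nat_Suc funpow.simps)
    moreover have "- of_nat (Suc n) * (of_nat w - of_nat n) \<noteq> (0::complex)"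
      using Suc.prems(2) by (simp del: of_nat_Suc)
    ultimately have "(lie_bracket L f ^^ n) y = \<zero>\<^bsub>L\<^esub>"
      by (rule smult_eq_zero) simp
    then show ?case using Suc by simp
  qed simp
  then show ?case using Suc.prems by simp
qed

text \<open>The computation behind the change of basis. Let \<open>(x, y)\<close> and \<open>(a, b)\<close> be the pairs of root
  vectors of two roots with inner product \<open>1\<close>, whose sum is not a root. Then \<open>[x, b]\<close> and \<open>[y, a]\<close>
  are root vectors of the difference of the two roots, they are normalized in the same way, and
  bracketing back recovers \<open>x\<close> up to sign.\<close>

lemma difference_root_vectors:
  assumes [simp]: "x \<in> carrier L" "y \<in> carrier L" "a \<in> carrier L" "b \<in> carrier L"
      "h \<in> carrier L" "g \<in> carrier L"
    and xa: "lie_bracket L x a = \<zero>\<^bsub>L\<^esub>" and yb: "lie_bracket L y b = \<zero>\<^bsub>L\<^esub>"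
    and xy: "lie_bracket L x y = (- 1) \<odot>\<^bsub>L\<^esub> h" and ab: "lie_bracket L a b = (- 1) \<odot>\<^bsub>L\<^esub> g"
    and ha: "lie_bracket L h a = a" and gx: "lie_bracket L g x = x" and gy: "lie_bracket L g y = (- 1) \<odot>\<^bsub>L\<^esub> y"
  shows "lie_bracket L (lie_bracket L x b) (lie_bracket L y a) = (- 1) \<odot>\<^bsub>L\<^esub> h \<oplus>\<^bsub>L\<^esub> g"
    and "lie_bracket L (lie_bracket L x b) a = (- 1) \<odot>\<^bsub>L\<^esub> x"
    and "lie_bracket L (lie_bracket L y a) b = (- 1) \<odot>\<^bsub>L\<^esub> y"
proof -
  note [simp] = bracket_closed
  have ba: "lie_bracket L b a = g"
    using bracket_anti[of b a] by (simp add: ab smult_smult)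
  have yg: "lie_bracket L y g = y" and xg: "lie_bracket L x g = (- 1) \<odot>\<^bsub>L\<^esub> x"
    using bracket_anti[of y g] bracket_anti[of x g] by (simp_all add: gx gy smult_smult)
  have by0: "lie_bracket L b y = \<zero>\<^bsub>L\<^esub>"
    using bracket_anti[of b y] by (simp add: yb)
  have b: "lie_bracket L b (lie_bracket L y a) = y"
    by (simp add: bracket_derivation[of b y a] by0 ba yg)
  have x: "lie_bracket L x (lie_bracket L y a) = (- 1) \<odot>\<^bsub>L\<^esub> a"
    by (simp add: bracket_derivation[of x y a] xa xy bracket_smult_left ha)
  have "lie_bracket L b a = (- 1) \<odot>\<^bsub>L\<^esub> lie_bracket L a b"
    by (rule bracket_anti) simp_all
  then show "lie_bracket L (lie_bracket L x b) (lie_bracket L y a) = (- 1) \<odot>\<^bsub>L\<^esub> h \<oplus>\<^bsub>L\<^esub> g"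
    by (simp add: bracket_bracket_left[of x b "lie_bracket L y a"] b x xy bracket_smult_right ba smult_smult)
  show "lie_bracket L (lie_bracket L x b) a = (- 1) \<odot>\<^bsub>L\<^esub> x"
    by (simp add: bracket_bracket_left[of x b a] xa ba xg)
  show "lie_bracket L (lie_bracket L y a) b = (- 1) \<odot>\<^bsub>L\<^esub> y"
    by (simp add: bracket_bracket_left[of y a b] yb ab bracket_smult_right yg)
qed

end


section \<open>Substitutions and quotients of presented Lie algebras\<close>

lemma lie_isomorphic_refl: "lie_isomorphic L L"
  unfolding lie_isomorphic_def
  by (intro bexI[of _ id]) (auto simp: lie_hom_def)

lemma lie_isomorphic_trans:
  assumes "lie_isomorphic L M" "lie_isomorphic M N"
  shows "lie_isomorphic L N"
proof -
  obtain f g where f: "f \<in> lie_hom L M" "bij_betw f (carrier L) (carrier M)"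
    and g: "g \<in> lie_hom M N" "bij_betw g (carrier M) (carrier N)"
    using assms by (auto simp: lie_isomorphic_def)
  have "g \<circ> f \<in> lie_hom L N"
    using f(1) g(1) by (auto simp: lie_hom_def Pi_iff)
  then show ?thesis
    using bij_betw_trans[OF f(2) g(2)] by (auto simp: lie_isomorphic_def)
qed

primrec lie_subst :: "('x \<Rightarrow> 'y lie_term) \<Rightarrow> 'x lie_term \<Rightarrow> 'y lie_term" where
  "lie_subst g (Gen x) = g x"
| "lie_subst g Zero = Zero"
| "lie_subst g (Plus s t) = Plus (lie_subst g s) (lie_subst g t)"
| "lie_subst g (Scale c t) = Scale c (lie_subst g t)"
| "lie_subst g (Bracket s t) = Bracket (lie_subst g s) (lie_subst g t)"

lemma lie_cong_subst:
  assumes "lie_cong R s t"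
    and "\<And>s t. (s, t) \<in> R \<Longrightarrow> lie_cong S (lie_subst g s) (lie_subst g t)"
  shows "lie_cong S (lie_subst g s) (lie_subst g t)"
  using assms(1)
proof induction
  case (rel s t)
  then show ?case by (rule assms(2))
next
  case (sym s t)
  then show ?case by (blast intro: lie_cong.sym)
next
  case (trans s t u)
  then show ?case by (blast intro: lie_cong.trans)
qed (auto simp del: lie_cong.plus_zero intro: lie_cong.intros)

lemma lie_subst_inverse:
  assumes "\<And>x. lie_cong R (lie_subst k (g x)) (Gen x)"
  shows "lie_cong R (lie_subst k (lie_subst g t)) t"
  by (induction t) (auto intro: assms lie_cong.refl lie_cong.cong_plus lie_cong.cong_scale lie_cong.cong_bracket)

lemma presented_isomorphic_by_subst:
  assumes g: "\<And>s t. (s, t) \<in> R \<Longrightarrow> lie_cong S (lie_subst g s) (lie_subst g t)"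
    and k: "\<And>s t. (s, t) \<in> S \<Longrightarrow> lie_cong R (lie_subst k s) (lie_subst k t)"
    and kg: "\<And>x. lie_cong R (lie_subst k (g x)) (Gen x)"
    and gk: "\<And>y. lie_cong S (lie_subst g (k y)) (Gen y)"
  shows "lie_isomorphic (presented_lie_algebra R) (presented_lie_algebra S)"
proof -
  \<comment> \<open>Respecting the relations makes the choice of a representative irrelevant.\<close>
  define f where "f U = lie_class S (lie_subst g (SOME t. t \<in> U))" for U
  have f: "f (lie_class R t) = lie_class S (lie_subst g t)" for t
  proof -
    have "lie_cong R t (SOME s. s \<in> lie_class R t)"
      using someI[of "\<lambda>s. s \<in> lie_class R t" t] by (simp add: mem_lie_class lie_cong.refl)
    then show ?thesis
      unfolding f_def lie_class_eq using lie_cong_subst[OF _ g] by (blast intro: lie_cong.sym)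
  qed
  have "f \<in> lie_hom (presented_lie_algebra R) (presented_lie_algebra S)"
    by (auto simp: lie_hom_def carrier_presented_lie_algebra presented_lie_algebra_simps f)
  moreover have "bij_betw f (carrier (presented_lie_algebra R)) (carrier (presented_lie_algebra S))"
    unfolding carrier_presented_lie_algebra
  proof (rule bij_betwI')
    fix U V assume "U \<in> range (lie_class R)" "V \<in> range (lie_class R)"
    then obtain s t where U: "U = lie_class R s" "V = lie_class R t" by auto
    have "lie_cong R s t" if "lie_cong S (lie_subst g s) (lie_subst g t)"
      using lie_cong_subst[OF that k] lie_subst_inverse[of R k g, OF kg]
      by (meson lie_cong.sym lie_cong.trans)
    then show "(f U = f V) = (U = V)"
      using lie_cong_subst[of R s t, OF _ g] by (auto simp: U f lie_class_eq)
  next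
    fix V assume "V \<in> range (lie_class S)"
    then obtain t where "V = lie_class S t" by auto
    then have "V = f (lie_class R (lie_subst k t))"
      using lie_subst_inverse[of S g k t, OF gk] by (simp add: f lie_class_eq lie_cong.sym)
    then show "\<exists>U\<in>range (lie_class R). V = f U" by blast
  qed (auto simp: f)
  ultimately show ?thesis by (auto simp: lie_isomorphic_def)
qed

lemma lie_subst_Gen [simp]: "lie_subst Gen t = t"
  by (induction t) auto

lemma lie_cong_mono: "lie_cong R s t \<Longrightarrow> R \<subseteq> S \<Longrightarrow> lie_cong S s t"
  using lie_cong_subst[of R s t S Gen] lie_cong.rel[of _ _ S] unfolding lie_subst_Gen by blast

lemma lie_cong_redundant:
  assumes "\<And>s t. (s, t) \<in> S \<Longrightarrow> lie_cong R s t" "R \<subseteq> S"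
  shows "lie_cong S = lie_cong R"
proof (intro ext iffI)
  fix s t assume *: "lie_cong S s t"
  show "lie_cong R s t" using lie_cong_subst[OF *, of R Gen] assms(1) by simp
qed (use assms(2) lie_cong_mono in blast)

text \<open>By induction over the congruence: the axioms of Lie algebras and the relations in \<open>R\<close> contribute
  the difference \<open>0\<close>, and the closure properties of an ideal match the congruence rules.\<close>

lemma difference_in_ideal:
  fixes R :: "('x lie_term \<times> 'x lie_term) set" and T :: "'x lie_term set"
  defines "L \<equiv> presented_lie_algebra R"
  assumes J: "lie_ideal J L" "lie_class R ` T \<subseteq> J"
    and "lie_cong (R \<union> (\<lambda>t. (t, Zero)) ` T) s t"
  shows "lie_class R s \<oplus>\<^bsub>L\<^esub> (- 1) \<odot>\<^bsub>L\<^esub> lie_class R t \<in> J"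
proof -
  interpret lie_algebra L unfolding L_def by (rule lie_algebra_presented)
  interpret J: submodule J complex_field L using J by (simp add: lie_ideal_def)
  note [simp] = bracket_closed
  have c [simp]: "lie_class R s \<in> carrier L" for s by (simp add: L_def carrier_presented_lie_algebra)
  have cls: "lie_class R Zero = \<zero>\<^bsub>L\<^esub>" "lie_class R (Plus s t) = lie_class R s \<oplus>\<^bsub>L\<^esub> lie_class R t"
    "lie_class R (Scale d t) = d \<odot>\<^bsub>L\<^esub> lie_class R t"
    "lie_class R (Bracket s t) = lie_bracket L (lie_class R s) (lie_class R t)" for s t d
    by (simp_all add: L_def presented_lie_algebra_simps)
  have JL: "x \<in> J \<Longrightarrow> x \<in> carrier L" for x using J by (auto simp: lie_ideal_def)
  have Jz: "\<zero>\<^bsub>L\<^esub> \<in> J" using J.one_closed by simp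
  have Ja: "x \<in> J \<Longrightarrow> y \<in> J \<Longrightarrow> x \<oplus>\<^bsub>L\<^esub> y \<in> J" for x y using J.m_closed by simp
  have Js: "x \<in> J \<Longrightarrow> d \<odot>\<^bsub>L\<^esub> x \<in> J" for x d using J.smult_closed[of d x] by (simp add: ring_of_type_algebra_def)
  have Jr: "x \<in> carrier L \<Longrightarrow> y \<in> J \<Longrightarrow> lie_bracket L x y \<in> J" for x y using J by (simp add: lie_ideal_def)
  have Jl: "x \<in> J \<Longrightarrow> y \<in> carrier L \<Longrightarrow> lie_bracket L x y \<in> J" for x y
    using bracket_anti[of x y] JL Jr Js by simp
  have *: "lie_class R s \<oplus>\<^bsub>L\<^esub> (- 1) \<odot>\<^bsub>L\<^esub> lie_class R t \<in> J" if "lie_cong R s t" for s t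
    using that unfolding lie_class_eq[symmetric] by (simp add: Jz)
  show ?thesis using assms(4)
  proof induction
    case (rel s t)
    then show ?case
    proof
      assume "(s, t) \<in> R"
      then show ?thesis by (intro * lie_cong.rel)
    next
      assume "(s, t) \<in> (\<lambda>t. (t, Zero)) ` T"
      then show ?thesis using J(2) by (auto simp: cls)
    qed
  next
    case (sym s t)
    have "lie_class R t \<oplus>\<^bsub>L\<^esub> (- 1) \<odot>\<^bsub>L\<^esub> lie_class R s =
        (- 1) \<odot>\<^bsub>L\<^esub> (lie_class R s \<oplus>\<^bsub>L\<^esub> (- 1) \<odot>\<^bsub>L\<^esub> lie_class R t)"
      by (simp add: smult_add_vector smult_smult a_comm)
    then show ?case using Js[OF sym.IH] by simp
  next
    case (trans s t u)
    have "lie_class R s \<oplus>\<^bsub>L\<^esub> (- 1) \<odot>\<^bsub>L\<^esub> lie_class R u =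
        (lie_class R s \<oplus>\<^bsub>L\<^esub> (- 1) \<odot>\<^bsub>L\<^esub> lie_class R t) \<oplus>\<^bsub>L\<^esub>
        (lie_class R t \<oplus>\<^bsub>L\<^esub> (- 1) \<odot>\<^bsub>L\<^esub> lie_class R u)"
      using r_neg1[of "lie_class R t" "(- 1) \<odot>\<^bsub>L\<^esub> lie_class R u"]
      by (simp add: a_assoc minus_eq_smult)
    then show ?case using Ja[OF trans.IH] by simp
  next
    case (cong_plus s s' t t')
    have "lie_class R (Plus s t) \<oplus>\<^bsub>L\<^esub> (- 1) \<odot>\<^bsub>L\<^esub> lie_class R (Plus s' t') =
        (lie_class R s \<oplus>\<^bsub>L\<^esub> (- 1) \<odot>\<^bsub>L\<^esub> lie_class R s') \<oplus>\<^bsub>L\<^esub>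
        (lie_class R t \<oplus>\<^bsub>L\<^esub> (- 1) \<odot>\<^bsub>L\<^esub> lie_class R t')"
      by (simp add: cls smult_add_vector a_ac)
    then show ?case using Ja[OF cong_plus.IH] by simp
  next
    case (cong_scale t t' d)
    have "lie_class R (Scale d t) \<oplus>\<^bsub>L\<^esub> (- 1) \<odot>\<^bsub>L\<^esub> lie_class R (Scale d t') =
        d \<odot>\<^bsub>L\<^esub> (lie_class R t \<oplus>\<^bsub>L\<^esub> (- 1) \<odot>\<^bsub>L\<^esub> lie_class R t')"
      by (simp add: cls smult_add_vector smult_smult)
    then show ?case using Js[OF cong_scale.IH] by simp
  next
    case (cong_bracket s s' t t')
    have "lie_class R (Bracket s t) \<oplus>\<^bsub>L\<^esub> (- 1) \<odot>\<^bsub>L\<^esub> lie_class R (Bracket s' t') =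
        lie_bracket L (lie_class R s \<oplus>\<^bsub>L\<^esub> (- 1) \<odot>\<^bsub>L\<^esub> lie_class R s') (lie_class R t) \<oplus>\<^bsub>L\<^esub>
        lie_bracket L (lie_class R s') (lie_class R t \<oplus>\<^bsub>L\<^esub> (- 1) \<odot>\<^bsub>L\<^esub> lie_class R t')"
      using r_neg1[of "lie_bracket L (lie_class R s') (lie_class R t)"
          "(- 1) \<odot>\<^bsub>L\<^esub> lie_bracket L (lie_class R s') (lie_class R t')"]
      by (simp add: cls bracket_add_left bracket_add_right bracket_smult_left bracket_smult_right
          a_assoc minus_eq_smult)
    then show ?case
      using Ja[OF Jl[OF cong_bracket.IH(1) c] Jr[OF c cong_bracket.IH(2)]] by simp
  qed (rule *, rule lie_cong.intros)+
qed


text \<open>A coset of the ideal is a set of classes of the congruence of \<open>R\<close>, and its union is a class of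
  the coarser congruence of \<open>S\<close>: the isomorphism simply takes unions.\<close>

lemma lie_quotient_presented:
  fixes R :: "('x lie_term \<times> 'x lie_term) set" and T :: "'x lie_term set"
  defines "L \<equiv> presented_lie_algebra R" and "S \<equiv> R \<union> (\<lambda>t. (t, Zero)) ` T"
  shows "lie_isomorphic (lie_quotient L (lie_ideal_generated L (lie_class R ` T))) (presented_lie_algebra S)"
proof -
  interpret lie_algebra L unfolding L_def by (rule lie_algebra_presented)
  note [simp] = bracket_closed
  have c [simp]: "lie_class R s \<in> carrier L" for s by (simp add: L_def carrier_presented_lie_algebra)
  note cls = presented_lie_algebra_simps[of R, folded L_def]
  have RS: "lie_cong R s t \<Longrightarrow> lie_cong S s t" for s t
    by (rule lie_cong_mono) (auto simp: S_def)
  let ?J = "lie_ideal_generated L (lie_class R ` T)"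
  define C where "C t = lie_class R ` {s. lie_cong S t s}" for t
  have mem_C: "lie_class R s \<in> C t \<longleftrightarrow> lie_cong S t s" for s t
  proof
    assume "lie_class R s \<in> C t"
    then obtain u where "lie_cong S t u" "lie_cong R s u" by (auto simp: C_def lie_class_eq)
    then show "lie_cong S t s" using RS[of s u] by (blast intro: lie_cong.sym lie_cong.trans)
  qed (simp add: C_def)
  have C_eq: "C s = C t \<longleftrightarrow> lie_cong S s t" for s t
  proof
    assume "C s = C t"
    then have "lie_class R t \<in> C s" by (simp add: mem_C lie_cong.refl)
    then show "lie_cong S s t" by (simp add: mem_C)
  next
    assume "lie_cong S s t"
    then have "lie_cong S s = lie_cong S t" by (blast intro: lie_cong.sym lie_cong.trans)
    then show "C s = C t" by (simp add: C_def)
  qed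
  have zz: "lie_cong S (Plus Zero Zero) Zero" "lie_cong S (Scale d Zero) Zero" for d
    using RS[of "Plus Zero Zero" Zero] RS[of "Scale d Zero" Zero] by (simp_all flip: lie_class_eq cls)
  have J: "?J = C Zero"
  proof
    have "lie_ideal (C Zero) L"
      unfolding lie_ideal_def
    proof (intro conjI ballI)
      have scale: "d \<odot>\<^bsub>L\<^esub> x \<in> C Zero" if x: "x \<in> C Zero" for d x
      proof -
        obtain t where t: "x = lie_class R t" "lie_cong S Zero t" using x by (auto simp: C_def)
        have "lie_cong S Zero (Scale d t)"
          using lie_cong.cong_scale[OF t(2)] zz(2) by (meson lie_cong.sym lie_cong.trans)
        then show ?thesis by (simp add: t cls mem_C)
      qed
      have plus: "x \<oplus>\<^bsub>L\<^esub> y \<in> C Zero" if xy: "x \<in> C Zero" "y \<in> C Zero" for x y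
      proof -
        obtain s t where t: "x = lie_class R s" "y = lie_class R t" "lie_cong S Zero s" "lie_cong S Zero t"
          using xy by (auto simp: C_def)
        have "lie_cong S Zero (Plus s t)"
          using lie_cong.cong_plus[OF t(3,4)] zz(1) by (meson lie_cong.sym lie_cong.trans)
        then show ?thesis by (simp add: t cls mem_C)
      qed
      have C_carrier: "C Zero \<subseteq> carrier L" by (auto simp: C_def)
      show "submodule (C Zero) complex_field L"
      proof (rule submoduleI)
        show "\<zero>\<^bsub>L\<^esub> \<in> C Zero" using mem_C[of Zero Zero] by (simp add: cls lie_cong.refl)
        show "\<ominus>\<^bsub>L\<^esub> x \<in> C Zero" if "x \<in> C Zero" for x
          using that scale C_carrier by (auto simp: minus_eq_smult)
      qed (use scale plus C_carrier in auto)
      show "C Zero \<subseteq> carrier L" by (auto simp: C_def)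
      fix x y assume "x \<in> carrier L" "y \<in> C Zero"
      then obtain s t where st: "x = lie_class R s" "y = lie_class R t" "lie_cong S Zero t"
        by (auto simp: C_def L_def carrier_presented_lie_algebra)
      have "lie_cong S (Bracket s Zero) Zero"
        by (rule RS) (simp flip: lie_class_eq cls)
      then have "lie_cong S Zero (Bracket s t)"
        using st(3) by (meson lie_cong.cong_bracket lie_cong.refl lie_cong.sym lie_cong.trans)
      then show "lie_bracket L x y \<in> C Zero" by (simp add: st cls mem_C)
    qed
    moreover have "lie_class R ` T \<subseteq> C Zero"
      by (auto simp: mem_C S_def intro!: lie_cong.sym[OF lie_cong.rel])
    ultimately show "?J \<subseteq> C Zero" by (auto simp: lie_ideal_generated_def)
    show "C Zero \<subseteq> ?J"
    proof
      fix x assume "x \<in> C Zero"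
      then obtain t where t: "x = lie_class R t" "lie_cong S t Zero"
        by (auto simp: C_def intro: lie_cong.sym)
      have "x \<in> J" if "lie_ideal J L" "lie_class R ` T \<subseteq> J" for J
        using difference_in_ideal[of J R T t Zero] that t
        by (simp add: S_def flip: L_def cls(1))
      then show "x \<in> ?J" by (auto simp: lie_ideal_generated_def)
    qed
  qed
  have cong_diff: "lie_cong S t u" if "lie_cong S Zero s" "lie_class R u = lie_class R (Plus s t)" for s t u
  proof -
    have "lie_cong S (Plus Zero t) (Plus s t)" using that(1) by (rule lie_cong.cong_plus[OF _ lie_cong.refl])
    moreover have "lie_cong S u (Plus s t)" using that(2) by (simp add: lie_class_eq RS)
    ultimately show ?thesis by (meson lie_cong.plus_zero lie_cong.sym lie_cong.trans)
  qed
  have split: "lie_cong S Zero (Plus u (Scale (- 1) t)) \<and>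
      lie_class R u = lie_class R (Plus (Plus u (Scale (- 1) t)) t)" if "lie_cong S t u" for t u
  proof
    have "lie_cong S (Plus u (Scale (- 1) t)) (Plus t (Scale (- 1) t))"
      by (rule lie_cong.cong_plus[OF lie_cong.sym[OF that] lie_cong.refl])
    moreover have "lie_cong S (Plus t (Scale (- 1) t)) Zero"
      by (rule RS) (simp flip: lie_class_eq cls)
    ultimately show "lie_cong S Zero (Plus u (Scale (- 1) t))"
      by (meson lie_cong.sym lie_cong.trans)
    show "lie_class R u = lie_class R (Plus (Plus u (Scale (- 1) t)) t)"
      by (simp add: a_assoc flip: cls)
  qed
  have coset: "?J +>\<^bsub>L\<^esub> lie_class R t = C t" for t
  proof
    show "?J +>\<^bsub>L\<^esub> lie_class R t \<subseteq> C t"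
    proof
      fix x assume "x \<in> ?J +>\<^bsub>L\<^esub> lie_class R t"
      then obtain y where y: "y \<in> C Zero" "x = y \<oplus>\<^bsub>L\<^esub> lie_class R t"
        unfolding J a_r_coset_def' by blast
      then obtain s where s: "lie_cong S Zero s" "y = lie_class R s" by (auto simp: C_def)
      then have x: "x = lie_class R (Plus s t)" using y(2) by (simp add: cls)
      show "x \<in> C t" unfolding x mem_C by (rule cong_diff[OF s(1) HOL.refl])
    qed
    show "C t \<subseteq> ?J +>\<^bsub>L\<^esub> lie_class R t"
    proof
      fix x assume "x \<in> C t"
      then obtain u where u: "x = lie_class R u" "lie_cong S t u" by (auto simp: C_def)
      then show "x \<in> ?J +>\<^bsub>L\<^esub> lie_class R t"
        using split[OF u(2)] unfolding J a_r_coset_def' u(1) cls(2)[symmetric] mem_C[symmetric]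
        by blast
    qed
  qed
  let ?Q = "lie_quotient L ?J"
  have Q_carrier: "carrier ?Q = range C"
    by (auto simp: lie_quotient_def A_RCOSETS_def' L_def[symmetric] coset
        carrier_presented_lie_algebra[of R, folded L_def])
  have UN1: "(\<Union>x\<in>C s. g x) = B" if "\<And>u. lie_cong S s u \<Longrightarrow> g (lie_class R u) = B" for s g and B :: "'x lie_term set set"
    using that lie_cong.refl[of S s] by (auto simp: C_def)
  have Q_smult: "d \<odot>\<^bsub>?Q\<^esub> C t = C (Scale d t)" for d t
    unfolding lie_quotient_def
    by simp (rule UN1, simp add: cls coset C_eq, rule lie_cong.cong_scale[OF lie_cong.sym])
  have Q_bracket: "lie_bracket ?Q (C s) (C t) = C (Bracket s t)" for s t
    unfolding lie_quotient_def
    by simp (rule UN1, rule UN1, simp add: cls coset C_eq, rule lie_cong.cong_bracket[OF lie_cong.sym lie_cong.sym])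
  have Q_add: "C s \<oplus>\<^bsub>?Q\<^esub> C t = C (Plus s t)" for s t
  proof
    show "C s \<oplus>\<^bsub>?Q\<^esub> C t \<subseteq> C (Plus s t)"
    proof
      fix x assume "x \<in> C s \<oplus>\<^bsub>?Q\<^esub> C t"
      then obtain u v where "lie_cong S s u" "lie_cong S t v" "x = lie_class R u \<oplus>\<^bsub>L\<^esub> lie_class R v"
        by (auto simp: lie_quotient_def set_add_def' C_def)
      then show "x \<in> C (Plus s t)"
        by (simp add: cls mem_C lie_cong.cong_plus)
    qed
    show "C (Plus s t) \<subseteq> C s \<oplus>\<^bsub>?Q\<^esub> C t"
    proof
      fix x assume "x \<in> C (Plus s t)"
      then obtain u where u: "x = lie_class R u" "lie_cong S (Plus s t) u" by (auto simp: C_def)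
      have "lie_cong S s (Plus (Plus s t) (Scale (- 1) t))"
        by (rule RS) (simp add: a_assoc flip: lie_class_eq cls)
      moreover have "lie_cong S (Plus (Plus s t) (Scale (- 1) t)) (Plus u (Scale (- 1) t))"
        using u(2) by (rule lie_cong.cong_plus[OF _ lie_cong.refl])
      ultimately have "lie_class R (Plus u (Scale (- 1) t)) \<in> C s"
        unfolding mem_C by (rule lie_cong.trans)
      moreover have "x = lie_class R (Plus u (Scale (- 1) t)) \<oplus>\<^bsub>L\<^esub> lie_class R t"
        by (simp add: u a_assoc flip: cls)
      moreover have "lie_class R t \<in> C t" by (simp add: mem_C lie_cong.refl)
      ultimately show "x \<in> C s \<oplus>\<^bsub>?Q\<^esub> C t"
        unfolding lie_quotient_def set_add_def' by simp blast
    qed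
  qed
  have Un: "\<Union> (C t) = lie_class S t" for t
  proof
    show "\<Union> (C t) \<subseteq> lie_class S t"
    proof
      fix u assume "u \<in> \<Union> (C t)"
      then obtain s where "lie_cong S t s" "lie_cong R s u" by (auto simp: C_def mem_lie_class)
      then show "u \<in> lie_class S t"
        unfolding mem_lie_class using RS lie_cong.trans by metis
    qed
    show "lie_class S t \<subseteq> \<Union> (C t)"
      using lie_cong.refl by (fastforce simp: C_def mem_lie_class)
  qed
  have "Union \<in> lie_hom ?Q (presented_lie_algebra S)"
    by (auto simp: lie_hom_def Q_carrier Q_add Q_smult Q_bracket Un
        presented_lie_algebra_simps carrier_presented_lie_algebra simp del: Union_iff)
  moreover have "bij_betw Union (carrier ?Q) (carrier (presented_lie_algebra S))"
    unfolding Q_carrier carrier_presented_lie_algebra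
  proof (rule bij_betwI')
    fix U V assume "U \<in> range C" "V \<in> range C"
    then obtain s t where "U = C s" "V = C t" by blast
    then show "(\<Union> U = \<Union> V) = (U = V)" by (simp only: Un C_eq lie_class_eq)
  next
    fix U assume "U \<in> range C"
    then obtain t where "U = C t" by blast
    then show "\<Union> U \<in> range (lie_class S)" by (simp only: Un rangeI)
  next
    fix V assume "V \<in> range (lie_class S)"
    then obtain t where "V = \<Union> (C t)" by (auto simp only: Un)
    then show "\<exists>U\<in>range C. V = \<Union> U" by blast
  qed
  ultimately show ?thesis by (auto simp: lie_isomorphic_def)
qed


section \<open>The form and gradings by the root lattice\<close>

lemma form_add_left: "form A (x + y) z = form A x z + form A y z"
  by (simp add: form_def algebra_simps sum.distrib)

lemma form_add_right: "form A x (y + z) = form A x y + form A x z"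
  by (simp add: form_def algebra_simps sum.distrib)

lemma form_smult_left: "form A (c *s x) z = c * form A x z"
  by (simp add: form_def algebra_simps sum_distrib_left)

lemma form_smult_right: "form A x (c *s z) = c * form A x z"
  by (simp add: form_def algebra_simps sum_distrib_left)

lemma form_zero [simp]: "form A 0 x = 0" "form A x 0 = 0"
  by (simp_all add: form_def)

lemma form_minus_left: "form A (- x) z = - form A x z"
  by (simp add: form_def sum_negf)

lemma form_minus_right: "form A x (- z) = - form A x z"
  by (simp add: form_def sum_negf)

lemma form_diff_left: "form A (x - y) z = form A x z - form A y z"
  using form_add_left[of A x "- y" z] by (simp add: form_minus_left)

lemma form_diff_right: "form A x (y - z) = form A x y - form A x z"
  using form_add_right[of A x y "- z"] by (simp add: form_minus_right)

lemmas form_linear = form_add_left form_add_right form_minus_left form_minus_right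
  form_diff_left form_diff_right form_smult_left form_smult_right

lemma form_axis_left: "form A (axis i 1) y = (\<Sum>j\<in>UNIV. of_int (A $ i $ j) * y $ j)"
proof -
  have "form A (axis i 1) y = (\<Sum>k\<in>UNIV. if k = i then (\<Sum>j\<in>UNIV. of_int (A $ i $ j) * y $ j) else 0)"
    unfolding form_def by (rule sum.cong) (auto simp: axis_def)
  then show ?thesis by simp
qed

lemma form_axis: "form A (axis i 1) (axis j 1) = of_int (A $ i $ j)"
proof -
  have "form A (axis i 1) (axis j 1) = (\<Sum>k\<in>UNIV. if k = j then of_int (A $ i $ j) else 0)"
    unfolding form_axis_left by (rule sum.cong) (auto simp: axis_def)
  then show ?thesis by simp
qed

lemma form_expand_left: "form A x y = (\<Sum>i\<in>UNIV. x $ i * form A (axis i 1) y)"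
  by (simp add: form_axis_left) (simp add: form_def sum_distrib_left algebra_simps)

lemma intersection_matrix_sym:
  fixes A :: "int^'n^'n"
  assumes "intersection_matrix A"
  shows "A $ i $ j = A $ j $ i"
proof -
  have "transpose A $ i $ j = A $ j $ i" by (simp add: transpose_def)
  then show ?thesis using assms by (simp add: intersection_matrix_def)
qed

lemma form_commute:
  assumes "intersection_matrix A"
  shows "form A x y = form A y x"
proof -
  have "form A x y = (\<Sum>j\<in>UNIV. \<Sum>i\<in>UNIV. x $ i * of_int (A $ i $ j) * y $ j)"
    unfolding form_def by (rule sum.swap)
  also have "\<dots> = form A y x"
    unfolding form_def
  proof (intro sum.cong)
    fix j i
    show "x $ i * of_int (A $ i $ j) * y $ j = y $ j * of_int (A $ j $ i) * x $ i"
      using intersection_matrix_sym[OF assms, of i j] by (simp add: mult_ac)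
  qed simp_all
  finally show ?thesis .
qed

definition cast_vec :: "int^'n \<Rightarrow> 'k::comm_ring_1^'n" where
  "cast_vec x = (\<chi> i. of_int (x $ i))"

lemma cast_vec_nth [simp]: "cast_vec x $ i = of_int (x $ i)"
  by (simp add: cast_vec_def)

lemma cast_vec_linear:
  "cast_vec (x + y) = cast_vec x + cast_vec y" "cast_vec (- x) = - cast_vec x"
  "cast_vec (x - y) = cast_vec x - cast_vec y" "cast_vec 0 = 0"
  by (simp_all add: vec_eq_iff)

lemma cast_vec_axis [simp]: "cast_vec (axis i 1) = axis i 1"
  by (simp add: vec_eq_iff axis_def)

lemma cast_vec_root_of [simp]: "cast_vec (root_of \<alpha>) = root_of \<alpha>"
  by (cases \<alpha>) (simp_all add: cast_vec_linear)

lemma form_cast_vec: "form A (cast_vec x) (cast_vec y) = of_int (form A x y)"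
  by (simp add: form_def)

lemma root_of_opposite [simp]: "root_of (opposite \<alpha>) = - root_of \<alpha>"
  by (cases \<alpha>) simp_all

lemma opposite_opposite [simp]: "opposite (opposite \<alpha>) = \<alpha>"
  by (cases \<alpha>) simp_all

lemma coroot_eq_root:
  assumes "intersection_matrix A"
  shows "coroot A \<alpha> = root_of \<alpha>"
  using assms by (cases \<alpha>) (simp_all add: coroot_def form_linear form_axis intersection_matrix_def)

text \<open>Homogeneous terms. Working with terms instead of elements makes the grading independent of
  the relations, so that it can be used in all quotients of \<open>tilde_algebra A\<close>.\<close>

inductive term_degree :: "int^'n \<Rightarrow> 'n generator lie_term \<Rightarrow> bool" where
  cartan: "term_degree 0 (cartan h)"
| root_vector: "term_degree (root_of \<alpha>) (root_vec \<alpha>)"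
| zero: "term_degree \<gamma> Zero"
| plus: "term_degree \<gamma> s \<Longrightarrow> term_degree \<gamma> t \<Longrightarrow> term_degree \<gamma> (Plus s t)"
| scale: "term_degree \<gamma> t \<Longrightarrow> term_degree \<gamma> (Scale c t)"
| bracket: "term_degree \<gamma> s \<Longrightarrow> term_degree \<delta> t \<Longrightarrow> term_degree (\<gamma> + \<delta>) (Bracket s t)"

definition IM_relations :: "int^'n^'n \<Rightarrow> ('n generator lie_term \<times> 'n generator lie_term) set" where
  "IM_relations A =
     tilde_relations A \<union> (\<lambda>t. (t, Zero)) ` {t. \<exists>\<gamma>. form A \<gamma> \<gamma> > 2 \<and> term_degree \<gamma> t}"

lemma homogeneous_iff:
  "homogeneous A \<gamma> x \<longleftrightarrow> (\<exists>t. term_degree \<gamma> t \<and> x = lie_class (tilde_relations A) t)"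
proof
  assume "homogeneous A \<gamma> x"
  then show "\<exists>t. term_degree \<gamma> t \<and> x = lie_class (tilde_relations A) t"
  proof induction
    case (smult \<gamma> x c)
    then show ?case
      by (metis tilde_algebra_def presented_lie_algebra_simps(3) term_degree.scale)
  qed (unfold tilde_algebra_def,
      (metis presented_lie_algebra_simps(1,2,4) term_degree.intros)+)
next
  have "homogeneous A \<gamma> (lie_class (tilde_relations A) t)" if "term_degree \<gamma> t" for t
    using that
  proof induction
    case (zero \<gamma>)
    show ?case using homogeneous.zero[of A \<gamma>] by (simp add: tilde_algebra_def presented_lie_algebra_simps)
  next
    case (plus \<gamma> s t)
    show ?case using homogeneous.add[OF plus.IH] by (simp add: tilde_algebra_def presented_lie_algebra_simps)
  next
    case (scale \<gamma> t c)
    show ?case using homogeneous.smult[OF scale.IH] by (simp add: tilde_algebra_def presented_lie_algebra_simps)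
  next
    case (bracket \<gamma> s \<delta> t)
    show ?case using homogeneous.bracket[OF bracket.IH] by (simp add: tilde_algebra_def presented_lie_algebra_simps)
  qed (rule homogeneous.intros)+
  then show "\<exists>t. term_degree \<gamma> t \<and> x = lie_class (tilde_relations A) t \<Longrightarrow> homogeneous A \<gamma> x"
    by blast
qed

lemma IM_isomorphic_presented: "lie_isomorphic (IM A) (presented_lie_algebra (IM_relations A))"
proof -
  have "{x. \<exists>\<gamma>. form A \<gamma> \<gamma> > 2 \<and> homogeneous A \<gamma> x} =
      lie_class (tilde_relations A) ` {t. \<exists>\<gamma>. form A \<gamma> \<gamma> > 2 \<and> term_degree \<gamma> t}"
    by (auto simp: homogeneous_iff)
  then show ?thesis
    unfolding IM_def IM_ideal_def IM_relations_def tilde_algebra_def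
    by (simp only: lie_quotient_presented)
qed

text \<open>Both the intersection matrix algebra and the Kac-Moody algebra are obtained from
  \<open>tilde_algebra A\<close> by adding relations.\<close>

locale tilde_quotient =
  fixes A :: "int^'n^'n" and R L
  assumes IM: "intersection_matrix A" and tilde: "tilde_relations A \<subseteq> R"
  defines "L \<equiv> presented_lie_algebra R"
begin

sublocale lie_algebra L
  unfolding L_def by (rule lie_algebra_presented)

abbreviation "cls \<equiv> lie_class R"

lemma cls_closed [simp]: "cls t \<in> carrier L"
  by (simp add: L_def carrier_presented_lie_algebra)

lemmas cls_simps = presented_lie_algebra_simps[of R, folded L_def, symmetric]

lemma cls_tilde: "(s, t) \<in> tilde_relations A \<Longrightarrow> cls s = cls t"
  using tilde by (auto simp: lie_class_eq intro: lie_cong.rel)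

lemma cls_cartan_add: "cls (cartan (g + h)) = cls (cartan g) \<oplus>\<^bsub>L\<^esub> cls (cartan h)"
  using cls_tilde[of "cartan (g + h)" "Plus (cartan g) (cartan h)"]
  by (auto simp: tilde_relations_def cls_simps)

lemma cls_cartan_smult: "cls (cartan (c *s h)) = c \<odot>\<^bsub>L\<^esub> cls (cartan h)"
  using cls_tilde[of "cartan (c *s h)" "Scale c (cartan h)"]
  by (auto simp: tilde_relations_def cls_simps)

lemma cls_cartan_minus: "cls (cartan (- h)) = (- 1) \<odot>\<^bsub>L\<^esub> cls (cartan h)"
  using cls_cartan_smult[of "-1" h] by simp

lemma bracket_cartan_cartan: "lie_bracket L (cls (cartan g)) (cls (cartan h)) = \<zero>\<^bsub>L\<^esub>"
  using cls_tilde[of "Bracket (cartan g) (cartan h)" Zero]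
  by (auto simp: tilde_relations_def cls_simps)

lemma bracket_cartan_root_vec:
  "lie_bracket L (cls (cartan h)) (cls (root_vec \<alpha>)) = form A h (root_of \<alpha>) \<odot>\<^bsub>L\<^esub> cls (root_vec \<alpha>)"
  using cls_tilde[of "Bracket (cartan h) (root_vec \<alpha>)" "Scale (form A h (root_of \<alpha>)) (root_vec \<alpha>)"]
  by (auto simp: tilde_relations_def cls_simps)

lemma bracket_opposite:
  "lie_bracket L (cls (root_vec \<alpha>)) (cls (root_vec (opposite \<alpha>))) = (- 1) \<odot>\<^bsub>L\<^esub> cls (cartan (root_of \<alpha>))"
  using cls_tilde[of "Bracket (root_vec \<alpha>) (root_vec (opposite \<alpha>))" "cartan (- coroot A \<alpha>)"]
  by (auto simp: tilde_relations_def cls_simps coroot_eq_root[OF IM] cls_cartan_minus)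

text \<open>Since the degree determines the weight, the action of the Cartan subalgebra on a candidate for
  a root vector is known as soon as the candidate is homogeneous.\<close>

lemma bracket_cartan_degree:
  "term_degree \<gamma> t \<Longrightarrow>
   lie_bracket L (cls (cartan h)) (cls t) = form A h (cast_vec \<gamma>) \<odot>\<^bsub>L\<^esub> cls t"
proof (induction rule: term_degree.induct)
  case (cartan g)
  then show ?case by (simp add: bracket_cartan_cartan cast_vec_linear)
next
  case (root_vector \<alpha>)
  then show ?case by (simp add: bracket_cartan_root_vec)
next
  case (plus \<gamma> s t)
  then show ?case by (simp add: cls_simps(2) bracket_add_right smult_add_vector)
next
  case (scale \<gamma> t c)
  then show ?case by (simp add: cls_simps(3) bracket_smult_right smult_smult mult.commute)
next
  case (bracket \<gamma> s \<delta> t)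
  then show ?case
    by (simp add: cls_simps(4) bracket_derivation[of "cls (cartan h)" "cls s" "cls t"]
        bracket_smult_right bracket_smult_left smult_add_scalar cast_vec_linear form_linear bracket_closed)
next
  case (zero \<gamma>)
  show ?case by (simp add: cls_simps(1))
qed

end

lemma tilde_quotient_IM: "intersection_matrix A \<Longrightarrow> tilde_quotient A (IM_relations A)"
  by unfold_locales (auto simp: IM_relations_def)


section \<open>Change of basis\<close>

text \<open>The columns of \<open>P\<close> are the elements of the new basis, \<open>gram A P\<close> is its matrix of inner
  products, and \<open>change_vec P\<close> converts new coordinates to old ones.\<close>

definition gram :: "int^'n^'n \<Rightarrow> int^'n^'n \<Rightarrow> int^'n^'n" where
  "gram A P = (\<chi> k l. form A (column k P) (column l P))"

definition change_vec :: "int^'n^'n \<Rightarrow> 'k::comm_ring_1^'n \<Rightarrow> 'k^'n" where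
  "change_vec P x = (\<chi> k. \<Sum>l\<in>UNIV. of_int (P $ k $ l) * x $ l)"

lemma change_vec_linear:
  "change_vec P (x + y) = change_vec P x + change_vec P y"
  "change_vec P (c *s x) = c *s change_vec P x"
  "change_vec P (- x) = - change_vec P x"
  "change_vec P (x - y) = change_vec P x - change_vec P y"
  "change_vec P 0 = 0"
  by (simp_all add: change_vec_def vec_eq_iff algebra_simps sum.distrib sum_distrib_left sum_negf sum_subtractf)

lemma change_vec_cast_vec: "change_vec P (cast_vec x) = cast_vec (change_vec P x)"
  by (simp add: change_vec_def vec_eq_iff)

lemma form_sum_left: "form A (\<Sum>k\<in>K. f k) y = (\<Sum>k\<in>K. form A (f k) y)"
  by (induction K rule: infinite_finite_induct) (simp_all add: form_add_left)

lemma form_sum_right: "form A x (\<Sum>k\<in>K. f k) = (\<Sum>k\<in>K. form A x (f k))"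
  by (induction K rule: infinite_finite_induct) (simp_all add: form_add_right)

lemma form_gram: "form (gram A P) x y = form A (change_vec P x) (change_vec P y)"
proof -
  have *: "change_vec P z = (\<Sum>k\<in>UNIV. z $ k *s cast_vec (column k P))" for z :: "'a^'b"
    by (simp add: vec_eq_iff change_vec_def column_def mult.commute)
  show ?thesis
    unfolding *[of x] form_sum_left form_smult_left
    unfolding *[of y] form_sum_right form_smult_right form_cast_vec
    by (simp add: form_def gram_def sum_distrib_left mult_ac)
qed

lemma gram_nth: "gram A P $ k $ l = form A (change_vec P (axis k 1)) (change_vec P (axis l 1))"
proof -
  have "gram A P $ k $ l = form (gram A P) (axis k 1) (axis l 1)"
    by (simp add: form_axis)
  then show ?thesis by (simp add: form_gram)
qed

lemma intersection_matrix_gram: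
  assumes "intersection_matrix A" "\<And>k. form A (change_vec P (axis k 1)) (change_vec P (axis k 1)) = (2::int)"
  shows "intersection_matrix (gram A P)"
  using assms(2) form_commute[OF assms(1)]
  by (auto simp: intersection_matrix_def transpose_def vec_eq_iff gram_nth)

definition base_subst ::
    "int^'n^'n \<Rightarrow> ('n signed_simple \<Rightarrow> 'n generator lie_term) \<Rightarrow> 'n generator \<Rightarrow> 'n generator lie_term" where
  "base_subst P g x = (case x of Cartan h \<Rightarrow> cartan (change_vec P h) | RootVector \<alpha> \<Rightarrow> g \<alpha>)"

lemma base_subst_simps [simp]:
  "base_subst P g (Cartan h) = cartan (change_vec P h)"
  "base_subst P g (RootVector \<alpha>) = g \<alpha>"
  by (simp_all add: base_subst_def)

lemma base_subst_degree:
  assumes "\<And>\<alpha>. term_degree (change_vec P (root_of \<alpha>)) (g \<alpha>)"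
  shows "term_degree \<gamma> t \<Longrightarrow> term_degree (change_vec P \<gamma>) (lie_subst (base_subst P g) t)"
  by (induction rule: term_degree.induct)
     (auto simp: change_vec_linear intro: term_degree.intros assms)

text \<open>A change of basis extends to the intersection matrix algebras as soon as the new simple roots
  have root vectors with the right brackets: their weights are determined by their degrees, and
  the remaining relations depend on the norm of a degree only.\<close>

lemma base_subst_relations:
  assumes A: "intersection_matrix A" "intersection_matrix (gram A P)"
    and deg: "\<And>\<alpha>. term_degree (change_vec P (root_of \<alpha>)) (g \<alpha>)"
    and br: "\<And>i. lie_cong (IM_relations A) (Bracket (g (Pos i)) (g (Neg i)))
                 (cartan (- change_vec P (root_of (Pos i))))"
    and st: "(s, t) \<in> IM_relations (gram A P)"
  shows "lie_cong (IM_relations A) (lie_subst (base_subst P g) s) (lie_subst (base_subst P g) t)"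
proof -
  interpret tilde_quotient A "IM_relations A" "presented_lie_algebra (IM_relations A)"
    by (rule tilde_quotient_IM[OF A(1)]) simp
  let ?L = "presented_lie_algebra (IM_relations A)"
  have br': "cls (Bracket (g \<alpha>) (g (opposite \<alpha>))) = cls (cartan (- change_vec P (root_of \<alpha>)))" for \<alpha>
  proof (cases \<alpha>)
    case (Pos i)
    then show ?thesis using br[of i] by (simp add: lie_class_eq)
  next
    case (Neg i)
    have "cls (Bracket (g (Neg i)) (g (Pos i))) = (- 1) \<odot>\<^bsub>?L\<^esub> cls (Bracket (g (Pos i)) (g (Neg i)))"
      by (simp add: cls_simps bracket_anti[of "cls (g (Neg i))"])
    also have "cls (Bracket (g (Pos i)) (g (Neg i))) = cls (cartan (- change_vec P (root_of (Pos i))))"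
      using br[of i] by (simp add: lie_class_eq)
    finally show ?thesis
      using Neg by (simp add: cls_cartan_minus[symmetric] change_vec_linear)
  qed
  from st show ?thesis
    unfolding IM_relations_def[of "gram A P"]
  proof
    assume "(s, t) \<in> tilde_relations (gram A P)"
    then consider h h' where "s = cartan (h + h')" "t = Plus (cartan h) (cartan h')"
      | c h where "s = cartan (c *s h)" "t = Scale c (cartan h)"
      | h h' where "s = Bracket (cartan h) (cartan h')" "t = Zero"
      | h \<alpha> where "s = Bracket (cartan h) (root_vec \<alpha>)" "t = Scale (form (gram A P) h (root_of \<alpha>)) (root_vec \<alpha>)"
      | \<alpha> where "s = Bracket (root_vec \<alpha>) (root_vec (opposite \<alpha>))" "t = cartan (- coroot (gram A P) \<alpha>)"
      by (auto simp: tilde_relations_def)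
    then show ?thesis
    proof cases
      case 1
      then show ?thesis unfolding lie_class_eq[symmetric]
        by (simp add: change_vec_linear cls_cartan_add cls_simps)
    next
      case 2
      then show ?thesis unfolding lie_class_eq[symmetric]
        by (simp add: change_vec_linear cls_cartan_smult cls_simps)
    next
      case 3
      then show ?thesis unfolding lie_class_eq[symmetric]
        by (simp add: bracket_cartan_cartan cls_simps)
    next
      case (4 h \<alpha>)
      have "cast_vec (change_vec P (root_of \<alpha>)) = (change_vec P (root_of \<alpha>) :: complex^'a)"
        by (simp add: change_vec_cast_vec[symmetric])
      then show ?thesis unfolding lie_class_eq[symmetric]
        by (simp add: 4 bracket_cartan_degree[OF deg] cls_simps form_gram)
    next
      case (5 \<alpha>)
      then show ?thesis unfolding lie_class_eq[symmetric]
        using br'[of \<alpha>] by (simp add: coroot_eq_root[OF A(2)] change_vec_linear)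
    qed
  next
    assume "(s, t) \<in> (\<lambda>t. (t, Zero)) ` {t. \<exists>\<gamma>. form (gram A P) \<gamma> \<gamma> > 2 \<and> term_degree \<gamma> t}"
    then obtain \<gamma> where *: "form (gram A P) \<gamma> \<gamma> > 2" "term_degree \<gamma> s" "t = Zero" by auto
    have "(lie_subst (base_subst P g) s, Zero) \<in> IM_relations A"
      using base_subst_degree[OF deg *(2)] *(1) by (auto simp: IM_relations_def form_gram)
    then show ?thesis by (simp add: *(3) lie_cong.rel)
  qed
qed

definition flip_matrix :: "'n set \<Rightarrow> int^'n^'n" where
  "flip_matrix N = (\<chi> k l. if k = l then (if k \<in> N then - 1 else 1) else 0)"

lemma change_vec_flip: "change_vec (flip_matrix N) x $ k = (if k \<in> N then - x $ k else x $ k)"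
proof -
  have "change_vec (flip_matrix N) x $ k = (\<Sum>l\<in>UNIV. if l = k then (if k \<in> N then - x $ k else x $ k) else 0)"
    unfolding change_vec_def flip_matrix_def vec_lambda_beta by (rule sum.cong) auto
  then show ?thesis by simp
qed

lemma change_vec_flip_axis:
  "change_vec (flip_matrix N) (axis k 1) = (if k \<in> N then - axis k 1 else axis k 1)"
  by (simp add: vec_eq_iff change_vec_flip axis_def)

lemma flip_flip: "change_vec (flip_matrix N) (change_vec (flip_matrix N) x) = x"
  by (simp add: vec_eq_iff change_vec_flip)

lemma gram_flip_flip: "gram (gram A (flip_matrix N)) (flip_matrix N) = A"
  by (simp add: vec_eq_iff gram_nth form_gram flip_flip form_axis)

lemma intersection_matrix_flip:
  assumes "intersection_matrix A" shows "intersection_matrix (gram A (flip_matrix N))"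
  using assms
  by (intro intersection_matrix_gram) (auto simp: change_vec_flip_axis form_linear form_axis intersection_matrix_def)

definition flip_root_vec :: "'n set \<Rightarrow> 'n::finite signed_simple \<Rightarrow> 'n generator lie_term" where
  "flip_root_vec N \<alpha> = root_vec (case \<alpha> of Pos i \<Rightarrow> if i \<in> N then Neg i else Pos i | Neg i \<Rightarrow> if i \<in> N then Pos i else Neg i)"

lemma flip_relations:
  assumes A: "intersection_matrix A" and st: "(s, t) \<in> IM_relations (gram A (flip_matrix N))"
  defines "f \<equiv> lie_subst (base_subst (flip_matrix N) (flip_root_vec N))"
  shows "lie_cong (IM_relations A) (f s) (f t)"
  unfolding f_def
proof (rule base_subst_relations[OF A intersection_matrix_flip[OF A] _ _ st])
  fix \<alpha> :: "'a signed_simple"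
  have "change_vec (flip_matrix N) (root_of \<alpha>) = (root_of (case \<alpha> of Pos i \<Rightarrow> if i \<in> N then Neg i else Pos i
      | Neg i \<Rightarrow> if i \<in> N then Pos i else Neg i) :: int^'a)"
    by (cases \<alpha>) (simp_all add: change_vec_flip_axis change_vec_linear)
  then show "term_degree (change_vec (flip_matrix N) (root_of \<alpha>)) (flip_root_vec N \<alpha>)"
    by (simp add: flip_root_vec_def term_degree.root_vector)
next
  fix i
  interpret tilde_quotient A "IM_relations A" "presented_lie_algebra (IM_relations A)"
    by (rule tilde_quotient_IM[OF A]) simp
  show "lie_cong (IM_relations A) (Bracket (flip_root_vec N (Pos i)) (flip_root_vec N (Neg i)))
        (cartan (- change_vec (flip_matrix N) (root_of (Pos i))))"
    unfolding lie_class_eq[symmetric]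
    using bracket_opposite[of "Pos i"] bracket_opposite[of "Neg i"]
    by (simp add: flip_root_vec_def cls_simps cls_cartan_minus[symmetric] change_vec_flip_axis)
qed

lemma IM_isomorphic_flip:
  assumes A: "intersection_matrix A"
  shows "lie_isomorphic (presented_lie_algebra (IM_relations A))
           (presented_lie_algebra (IM_relations (gram A (flip_matrix N))))"
proof (rule presented_isomorphic_by_subst)
  let ?g = "base_subst (flip_matrix N) (flip_root_vec N)"
  fix s t
  show "(s, t) \<in> IM_relations A \<Longrightarrow>
      lie_cong (IM_relations (gram A (flip_matrix N))) (lie_subst ?g s) (lie_subst ?g t)"
    using flip_relations[OF intersection_matrix_flip[OF A, of N], of s t N] by (simp add: gram_flip_flip)
  show "(s, t) \<in> IM_relations (gram A (flip_matrix N)) \<Longrightarrow>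
      lie_cong (IM_relations A) (lie_subst ?g s) (lie_subst ?g t)"
    by (rule flip_relations[OF A])
next
  let ?g = "base_subst (flip_matrix N) (flip_root_vec N)"
  have *: "lie_subst ?g (?g x) = Gen x" for x
    by (cases x) (auto simp: flip_flip flip_root_vec_def split: signed_simple.split)
  fix x
  show "lie_cong (IM_relations A) (lie_subst ?g (?g x)) (Gen x)"
    "lie_cong (IM_relations (gram A (flip_matrix N))) (lie_subst ?g (?g x)) (Gen x)"
    unfolding * by (rule lie_cong.refl)+
qed


definition shear_matrix :: "'n \<Rightarrow> 'n \<Rightarrow> int \<Rightarrow> int^'n^'n" where
  "shear_matrix i j c = (\<chi> k l. (if k = l then 1 else 0) + (if k = i \<and> l = j then - c else 0))"

lemma change_vec_shear:
  "change_vec (shear_matrix i j c) x $ k = x $ k - (if k = i then of_int c * x $ j else 0)"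
proof -
  have "change_vec (shear_matrix i j c) x $ k =
      (\<Sum>l\<in>UNIV. (if l = k then x $ k else 0) + (if l = j then (if k = i then - of_int c * x $ j else 0) else 0))"
    unfolding change_vec_def shear_matrix_def vec_lambda_beta
    by (rule sum.cong) (auto simp: algebra_simps)
  then show ?thesis by (simp add: sum.distrib)
qed

lemma change_vec_shear_axis:
  "change_vec (shear_matrix i j c) (axis k 1) =
    (if k = j then axis j 1 - of_int c *s axis i 1 else axis k 1)"
  by (auto simp: vec_eq_iff change_vec_shear axis_def)

lemma shear_shear:
  "i \<noteq> j \<Longrightarrow> change_vec (shear_matrix i j (- c)) (change_vec (shear_matrix i j c) x) = x"
  by (auto simp: vec_eq_iff change_vec_shear)

lemma shear_shear':
  "i \<noteq> j \<Longrightarrow> change_vec (shear_matrix i j c) (change_vec (shear_matrix i j (- c)) x) = x"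
  using shear_shear[of i j "- c" x] by simp

lemma gram_shear_shear: "i \<noteq> j \<Longrightarrow> gram (gram A (shear_matrix i j c)) (shear_matrix i j (- c)) = A"
  by (simp add: vec_eq_iff gram_nth form_gram shear_shear' form_axis)

text \<open>Let \<open>\<beta> = c \<alpha>\<^sub>i\<close>, so that \<open>\<alpha>\<^sub>j\<close> and \<open>\<beta>\<close> have inner product \<open>1\<close> in the situation of interest. The
  root vectors of the new simple root \<open>\<alpha>\<^sub>j - \<beta>\<close> and of its negative are scaled by the sign \<open>c\<close>
  because bracketing with the root vectors of \<open>-\<beta>\<close> and then of \<open>\<beta>\<close> changes the sign: with this
  factor, the substitution for \<open>-c\<close> is the exact inverse of the one for \<open>c\<close>.\<close>

definition shear_root_vec :: "'n \<Rightarrow> 'n \<Rightarrow> int \<Rightarrow> 'n::finite signed_simple \<Rightarrow> 'n generator lie_term" where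
  "shear_root_vec i j c \<alpha> =
    (let \<beta> = (if c = 1 then Pos i else Neg i) in
     if \<alpha> = Pos j then Scale (of_int c) (Bracket (root_vec (Pos j)) (root_vec (opposite \<beta>)))
     else if \<alpha> = Neg j then Scale (of_int c) (Bracket (root_vec (Neg j)) (root_vec \<beta>))
     else root_vec \<alpha>)"

text \<open>The situation in which the shear is a reflection: the inner product of \<open>\<alpha>\<^sub>i\<close> and \<open>\<alpha>\<^sub>j\<close> is
  \<open>c = \<plusminus>1\<close>. The new matrix has \<open>-c\<close> in this place, so that the situation is symmetric.\<close>

locale shear =
  fixes A :: "int^'n^'n" and i j :: 'n and c :: int
  assumes A: "intersection_matrix A" and ij: "i \<noteq> j" and Aij: "A $ i $ j = c" and c: "c = 1 \<or> c = -1"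
begin

lemma A_diag: "A $ k $ k = 2"
  using A by (simp add: intersection_matrix_def)

lemma Aji: "A $ j $ i = c"
  using intersection_matrix_sym[OF A, of i j] Aij by simp

lemma intersection_matrix_shear: "intersection_matrix (gram A (shear_matrix i j c))"
  using c by (intro intersection_matrix_gram[OF A])
    (auto simp: change_vec_shear_axis form_linear form_axis A_diag Aij Aji)

lemma gram_shear_nth: "gram A (shear_matrix i j c) $ i $ j = - c"
  using ij by (simp add: gram_nth change_vec_shear_axis form_linear form_axis A_diag Aij)

lemma shear_opposite: "shear (gram A (shear_matrix i j c)) i j (- c)"
  using intersection_matrix_shear ij gram_shear_nth c by (auto intro!: shear.intro)

sublocale tilde_quotient A "IM_relations A" "presented_lie_algebra (IM_relations A)"
  by (rule tilde_quotient_IM[OF A]) simp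

abbreviation "L \<equiv> presented_lie_algebra (IM_relations A)"

definition \<beta> where "\<beta> = (if c = 1 then Pos i else Neg i)"

lemma form_\<beta>: "form A (axis j 1) (root_of \<beta>) = (1::int)" "form A (root_of \<beta>) (axis j 1) = (1::int)"
  "form A (axis j 1) (root_of \<beta>) = (1::complex)" "form A (root_of \<beta>) (axis j 1) = (1::complex)"
  "form A (root_of \<beta>) (root_of \<beta>) = (2::int)"
  using c by (auto simp: \<beta>_def form_linear form_axis Aij Aji A_diag)

lemma root_of_\<beta>: "root_of \<beta> = of_int c *s axis i 1"
  using c by (auto simp: \<beta>_def vec_eq_iff)

lemma bracket_sum_not_root:
  assumes "form A (root_of \<alpha> + root_of \<alpha>') (root_of \<alpha> + root_of \<alpha>') > (2::int)"
  shows "lie_bracket L (cls (root_vec \<alpha>)) (cls (root_vec \<alpha>')) = \<zero>\<^bsub>L\<^esub>"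
proof -
  have "(Bracket (root_vec \<alpha>) (root_vec \<alpha>'), Zero) \<in> IM_relations A"
    using assms by (auto simp: IM_relations_def intro!: exI[of _ "root_of \<alpha> + root_of \<alpha>'"] term_degree.intros)
  then have "cls (Bracket (root_vec \<alpha>) (root_vec \<alpha>')) = cls Zero"
    by (simp add: lie_class_eq lie_cong.rel)
  then show ?thesis by (simp add: cls_simps)
qed

lemmas shear_brackets = difference_root_vectors[of "cls (root_vec (Pos j))" "cls (root_vec (Neg j))"
    "cls (root_vec \<beta>)" "cls (root_vec (opposite \<beta>))" "cls (cartan (axis j 1))" "cls (cartan (root_of \<beta>))",
    OF cls_closed cls_closed cls_closed cls_closed cls_closed cls_closed]

lemma shear_bracket_hyps:
  "lie_bracket L (cls (root_vec (Pos j))) (cls (root_vec \<beta>)) = \<zero>\<^bsub>L\<^esub>"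
  "lie_bracket L (cls (root_vec (Neg j))) (cls (root_vec (opposite \<beta>))) = \<zero>\<^bsub>L\<^esub>"
  "lie_bracket L (cls (root_vec (Pos j))) (cls (root_vec (Neg j))) = (- 1) \<odot>\<^bsub>L\<^esub> cls (cartan (axis j 1))"
  "lie_bracket L (cls (root_vec \<beta>)) (cls (root_vec (opposite \<beta>))) = (- 1) \<odot>\<^bsub>L\<^esub> cls (cartan (root_of \<beta>))"
  "lie_bracket L (cls (cartan (axis j 1))) (cls (root_vec \<beta>)) = cls (root_vec \<beta>)"
  "lie_bracket L (cls (cartan (root_of \<beta>))) (cls (root_vec (Pos j))) = cls (root_vec (Pos j))"
  "lie_bracket L (cls (cartan (root_of \<beta>))) (cls (root_vec (Neg j))) = (- 1) \<odot>\<^bsub>L\<^esub> cls (root_vec (Neg j))"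
  using bracket_opposite[of "Pos j"] bracket_opposite[of \<beta>]
  by (simp_all add: bracket_sum_not_root form_linear form_\<beta> form_axis A_diag bracket_cartan_root_vec)

lemma shear_root_vec_j:
  "shear_root_vec i j c (Pos j) = Scale (of_int c) (Bracket (root_vec (Pos j)) (root_vec (opposite \<beta>)))"
  "shear_root_vec i j c (Neg j) = Scale (of_int c) (Bracket (root_vec (Neg j)) (root_vec \<beta>))"
  by (simp_all add: shear_root_vec_def \<beta>_def Let_def)

lemma shear_root_vec_other:
  "k \<noteq> j \<Longrightarrow> shear_root_vec i j c (Pos k) = root_vec (Pos k)"
  "k \<noteq> j \<Longrightarrow> shear_root_vec i j c (Neg k) = root_vec (Neg k)"
  by (simp_all add: shear_root_vec_def Let_def)

lemma shear_relations:
  assumes st: "(s, t) \<in> IM_relations (gram A (shear_matrix i j c))"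
  defines "f \<equiv> lie_subst (base_subst (shear_matrix i j c) (shear_root_vec i j c))"
  shows "lie_cong (IM_relations A) (f s) (f t)"
  unfolding f_def
proof (rule base_subst_relations[OF A intersection_matrix_shear _ _ st])
  fix \<alpha> :: "'n signed_simple"
  have j: "change_vec (shear_matrix i j c) (axis j 1) = axis j 1 - (root_of \<beta> :: 'k::comm_ring_1^'n)"
    by (simp add: change_vec_shear_axis root_of_\<beta>)
  show "term_degree (change_vec (shear_matrix i j c) (root_of \<alpha>)) (shear_root_vec i j c \<alpha>)"
  proof (cases "\<alpha> = Pos j \<or> \<alpha> = Neg j")
    case True
    have "term_degree (root_of (Pos j) + root_of (opposite \<beta>)) (shear_root_vec i j c (Pos j))"
      "term_degree (root_of (Neg j) + root_of \<beta>) (shear_root_vec i j c (Neg j))"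
      unfolding shear_root_vec_j by (intro term_degree.intros)+
    then show ?thesis using True by (auto simp: j change_vec_linear)
  next
    case False
    then obtain k where k: "k \<noteq> j" "\<alpha> = Pos k \<or> \<alpha> = Neg k" by (cases \<alpha>) auto
    have "term_degree (root_of \<alpha>) (root_vec \<alpha>)" by (rule term_degree.root_vector)
    then show ?thesis
      using k by (auto simp: shear_root_vec_other change_vec_shear_axis change_vec_linear)
  qed
next
  fix k
  have j: "change_vec (shear_matrix i j c) (axis j 1) = axis j 1 - (root_of \<beta> :: complex^'n)"
    by (simp add: change_vec_shear_axis root_of_\<beta>)
  show "lie_cong (IM_relations A) (Bracket (shear_root_vec i j c (Pos k)) (shear_root_vec i j c (Neg k)))
        (cartan (- change_vec (shear_matrix i j c) (root_of (Pos k))))"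
  proof (cases "k = j")
    case True
    have "of_int c * of_int c = (1::complex)" using c by auto
    moreover have "cls (cartan (- (axis j 1 - root_of \<beta>))) =
        (- 1) \<odot>\<^bsub>L\<^esub> cls (cartan (axis j 1)) \<oplus>\<^bsub>L\<^esub> cls (cartan (root_of \<beta>))"
      using cls_cartan_add[of "- axis j 1" "root_of \<beta>"] by (simp add: cls_cartan_minus)
    ultimately show ?thesis
      unfolding lie_class_eq[symmetric] True shear_root_vec_j
      using shear_brackets(1)[OF shear_bracket_hyps]
      by (simp add: cls_simps bracket_smult_left bracket_smult_right smult_smult bracket_closed j)
  next
    case False
    then show ?thesis
      unfolding lie_class_eq[symmetric] shear_root_vec_other[OF False]
      using bracket_opposite[of "Pos k"]
      by (simp add: cls_simps change_vec_shear_axis cls_cartan_minus)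
  qed
qed

lemma shear_back:
  "lie_cong (IM_relations A)
    (lie_subst (base_subst (shear_matrix i j c) (shear_root_vec i j c)) (shear_root_vec i j (- c) \<alpha>)) (root_vec \<alpha>)"
proof -
  let ?f = "lie_subst (base_subst (shear_matrix i j c) (shear_root_vec i j c))"
  have \<beta>': "(if - c = 1 then Pos i else Neg i) = opposite \<beta>" using c by (auto simp: \<beta>_def)
  have \<beta>: "shear_root_vec i j c \<beta> = root_vec \<beta>" "shear_root_vec i j c (opposite \<beta>) = root_vec (opposite \<beta>)"
    using ij by (auto simp: \<beta>_def shear_root_vec_def Let_def)
  have inverse_j: "shear_root_vec i j (- c) (Pos j) = Scale (- of_int c) (Bracket (root_vec (Pos j)) (root_vec \<beta>))"
    "shear_root_vec i j (- c) (Neg j) = Scale (- of_int c) (Bracket (root_vec (Neg j)) (root_vec (opposite \<beta>)))"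
    unfolding shear_root_vec_def \<beta>' Let_def by simp_all
  have cc: "of_int c * of_int c = (1::complex)" using c by auto
  consider "\<alpha> = Pos j" | "\<alpha> = Neg j" | k where "k \<noteq> j" "\<alpha> = Pos k \<or> \<alpha> = Neg k"
    by (cases \<alpha>) auto
  then show ?thesis
  proof cases
    case 1
    show ?thesis
      unfolding lie_class_eq[symmetric] 1 inverse_j
      using shear_brackets(2)[OF shear_bracket_hyps]
      by (simp add: \<beta> shear_root_vec_j cls_simps bracket_smult_left smult_smult bracket_closed cc)
  next
    case 2
    show ?thesis
      unfolding lie_class_eq[symmetric] 2 inverse_j
      using shear_brackets(3)[OF shear_bracket_hyps]
      by (simp add: \<beta> shear_root_vec_j cls_simps bracket_smult_left smult_smult bracket_closed cc)
  next
    case 3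
    then have "?f (shear_root_vec i j (- c) \<alpha>) = root_vec \<alpha>"
      by (auto simp: shear_root_vec_def Let_def)
    then show ?thesis by (simp add: lie_cong.refl)
  qed
qed

end

lemma IM_isomorphic_shear:
  assumes "shear A i j c"
  shows "lie_isomorphic (presented_lie_algebra (IM_relations A))
           (presented_lie_algebra (IM_relations (gram A (shear_matrix i j c))))"
proof -
  let ?A' = "gram A (shear_matrix i j c)"
  let ?f = "base_subst (shear_matrix i j c) (shear_root_vec i j c)"
  let ?g = "base_subst (shear_matrix i j (- c)) (shear_root_vec i j (- c))"
  interpret shear A i j c by fact
  interpret inverse: shear ?A' i j "- c" by (rule shear_opposite)
  note inv = gram_shear_shear[OF ij, of A c]
  show ?thesis
  proof (rule presented_isomorphic_by_subst)
    show "lie_cong (IM_relations ?A') (lie_subst ?g s) (lie_subst ?g t)" if "(s, t) \<in> IM_relations A" for s t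
      using inverse.shear_relations[of s t] that by (simp add: inv)
    show "lie_cong (IM_relations A) (lie_subst ?f s) (lie_subst ?f t)" if "(s, t) \<in> IM_relations ?A'" for s t
      using shear_relations that by blast
    show "lie_cong (IM_relations A) (lie_subst ?f (?g x)) (Gen x)" for x
      using shear_back ij by (cases x) (auto simp: shear_shear' intro: lie_cong.refl)
    show "lie_cong (IM_relations ?A') (lie_subst ?g (?f x)) (Gen x)" for x
      using inverse.shear_back ij by (cases x) (auto simp: shear_shear intro: lie_cong.refl)
  qed
qed


section \<open>Roots of Kac-Moody algebras\<close>

text \<open>The simple roots and their negatives are treated uniformly by means of a sign \<open>s\<close>.\<close>

fun signed :: "bool \<Rightarrow> 'n \<Rightarrow> 'n signed_simple" where
  "signed True i = Pos i"
| "signed False i = Neg i"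

fun cone_sign :: "bool \<Rightarrow> int" where
  "cone_sign True = 1"
| "cone_sign False = - 1"

lemma root_of_signed: "(root_of (signed s i) :: int^'n) $ k = (if k = i then cone_sign s else 0)"
  by (cases s) (auto simp: axis_def)

lemma signed_cases: obtains s i where "\<alpha> = signed s i"
  by (cases \<alpha>) (metis signed.simps)+

lemma opposite_signed [simp]: "opposite (signed s i) = signed (\<not> s) i"
  by (cases s) auto

lemma root_of_signed_not [simp]:
  "root_of (signed s i) + root_of (signed (\<not> s) i) = 0"
  by (cases s) simp_all

lemma signed_eq [simp]: "signed s i = signed r j \<longleftrightarrow> s = r \<and> i = j"
  by (cases s; cases r) auto

lemma root_of_eq_iff [simp]: "(root_of \<alpha> :: int^'n) = root_of \<beta> \<longleftrightarrow> \<alpha> = \<beta>"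
proof
  assume eq: "(root_of \<alpha> :: int^'n) = root_of \<beta>"
  obtain s i r j where a: "\<alpha> = signed s i" "\<beta> = signed r j" by (metis signed_cases)
  have "(root_of (signed s i) :: int^'n) $ i = root_of (signed r j) $ i" using eq a by simp
  then show "\<alpha> = \<beta>"
    unfolding a root_of_signed by (cases s; cases r) (auto split: if_splits)
qed simp

text \<open>The possible degrees in the nilradical other than the simple roots: a vector with at most one
  nonzero coordinate is excluded because a simple root vector commutes with itself.\<close>

definition inner_cone :: "bool \<Rightarrow> int^'n \<Rightarrow> bool" where
  "inner_cone s \<gamma> \<longleftrightarrow> (\<forall>k. 0 \<le> cone_sign s * \<gamma> $ k) \<and> (\<exists>k l. k \<noteq> l \<and> \<gamma> $ k \<noteq> 0 \<and> \<gamma> $ l \<noteq> 0)"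

locale kac_moody =
  fixes B :: "int^'n^'n"
  assumes gcm: "symmetric_generalized_cartan_matrix B"
begin

lemma IM_B: "intersection_matrix B"
  using gcm by (simp add: symmetric_generalized_cartan_matrix_def)

lemma B_diag: "B $ i $ i = 2"
  using IM_B by (simp add: intersection_matrix_def)

sublocale tilde_quotient B "kac_moody_relations B" "presented_lie_algebra (kac_moody_relations B)"
  by unfold_locales (auto simp: IM_B kac_moody_relations_def)

abbreviation "L \<equiv> presented_lie_algebra (kac_moody_relations B)"
abbreviation "E \<alpha> \<equiv> cls (root_vec \<alpha>)"
abbreviation "H h \<equiv> cls (cartan h)"

lemma cls_relation: "(s, t) \<in> kac_moody_relations B \<Longrightarrow> cls s = cls t"
  by (simp add: lie_class_eq lie_cong.rel)

lemma cls_ad_power: "cls ((Bracket s ^^ n) t) = (lie_bracket L (cls s) ^^ n) (cls t)"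
  by (induction n) (simp_all add: cls_simps)

lemma bracket_mixed: "i \<noteq> j \<Longrightarrow> lie_bracket L (E (signed s i)) (E (signed (\<not> s) j)) = \<zero>\<^bsub>L\<^esub>"
proof (cases s)
  case True
  assume "i \<noteq> j"
  then have "cls (Bracket (root_vec (Pos i)) (root_vec (Neg j))) = cls Zero"
    by (intro cls_relation) (auto simp: kac_moody_relations_def)
  then show ?thesis using True by (simp add: cls_simps)
next
  case False
  assume "i \<noteq> j"
  then have "cls (Bracket (root_vec (Pos j)) (root_vec (Neg i))) = cls Zero"
    by (intro cls_relation) (auto simp: kac_moody_relations_def)
  then show ?thesis using False bracket_anti[of "E (Neg i)" "E (Pos j)"] by (simp add: cls_simps)
qed

lemma serre: "i \<noteq> j \<Longrightarrow>
  (lie_bracket L (E (signed s i)) ^^ nat (1 - B $ i $ j)) (E (signed s j)) = \<zero>\<^bsub>L\<^esub>"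
proof -
  assume "i \<noteq> j"
  then have "cls ((Bracket (root_vec (signed s i)) ^^ nat (1 - B $ i $ j)) (root_vec (signed s j))) = cls Zero"
    by (intro cls_relation, cases s) (auto simp: kac_moody_relations_def)
  then show ?thesis unfolding cls_ad_power by (simp add: cls_simps)
qed

text \<open>The span of the iterated brackets of simple root vectors of sign \<open>s\<close>, degree by degree.\<close>

inductive nilradical :: "bool \<Rightarrow> int^'n \<Rightarrow> 'n generator lie_term set \<Rightarrow> bool" for s where
  root: "nilradical s (root_of (signed s i)) (E (signed s i))"
| step: "nilradical s \<gamma> x \<Longrightarrow>
    nilradical s (root_of (signed s i) + \<gamma>) (lie_bracket L (E (signed s i)) x)"
| zero: "nilradical s \<gamma> \<zero>\<^bsub>L\<^esub>"
| add: "nilradical s \<gamma> x \<Longrightarrow> nilradical s \<gamma> y \<Longrightarrow> nilradical s \<gamma> (x \<oplus>\<^bsub>L\<^esub> y)"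
| smult: "nilradical s \<gamma> x \<Longrightarrow> nilradical s \<gamma> (c \<odot>\<^bsub>L\<^esub> x)"

lemma nilradical_degree: "nilradical s \<gamma> x \<Longrightarrow> \<exists>t. term_degree \<gamma> t \<and> x = cls t"
proof (induction rule: nilradical.induct)
  case (root i)
  then show ?case using term_degree.root_vector by blast
next
  case (step \<gamma> x i)
  then obtain t where "term_degree \<gamma> t" "x = cls t" by blast
  then show ?case
    using term_degree.bracket[OF term_degree.root_vector[of "signed s i"]] cls_simps(4) by metis
next
  case (zero \<gamma>)
  then show ?case using term_degree.zero cls_simps(1) by metis
next
  case (add \<gamma> x y)
  then obtain t u where "term_degree \<gamma> t" "x = cls t" "term_degree \<gamma> u" "y = cls u" by blast
  then show ?case using term_degree.plus cls_simps(2) by metis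
next
  case (smult \<gamma> x c)
  then obtain t where "term_degree \<gamma> t" "x = cls t" by blast
  then show ?case using term_degree.scale cls_simps(3) by metis
qed

lemma nilradical_closed [simp]: "nilradical s \<gamma> x \<Longrightarrow> x \<in> carrier L"
  using nilradical_degree by fastforce

lemma bracket_cartan_nilradical:
  "nilradical s \<gamma> x \<Longrightarrow> lie_bracket L (H h) x = form B h (cast_vec \<gamma>) \<odot>\<^bsub>L\<^esub> x"
  using nilradical_degree bracket_cartan_degree by blast

lemma nilradical_support:
  "nilradical s \<gamma> x \<Longrightarrow> x = \<zero>\<^bsub>L\<^esub> \<or>
    (\<exists>i c. \<gamma> = root_of (signed s i) \<and> x = c \<odot>\<^bsub>L\<^esub> E (signed s i)) \<or> inner_cone s \<gamma>"
proof (induction rule: nilradical.induct)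
  case (root i)
  have "E (signed s i) = 1 \<odot>\<^bsub>L\<^esub> E (signed s i)" by simp
  then show ?case by metis
next
  case (step \<gamma> x i)
  have s: "cone_sign s * cone_sign s = 1" "cone_sign s \<noteq> 0" by (cases s; simp)+
  from step.IH consider "x = \<zero>\<^bsub>L\<^esub>"
    | j c where "\<gamma> = root_of (signed s j)" "x = c \<odot>\<^bsub>L\<^esub> E (signed s j)" | "inner_cone s \<gamma>" by blast
  then show ?case
  proof cases
    case 1
    then show ?thesis by simp
  next
    case (2 j c)
    show ?thesis
    proof (cases "i = j")
      case True
      then show ?thesis using 2 by (simp add: bracket_smult_right bracket_self)
    next
      case False
      then have "inner_cone s (root_of (signed s i) + \<gamma>)"
        unfolding inner_cone_def 2(1) vector_add_component root_of_signed
        using s by (auto simp: algebra_simps intro!: exI[of _ i] exI[of _ j])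
      then show ?thesis by blast
    qed
  next
    case 3
    have *: "cone_sign s * (root_of (signed s i) + \<gamma>) $ k = cone_sign s * \<gamma> $ k + (if k = i then 1 else 0)" for k
      unfolding vector_add_component root_of_signed using s by (simp add: algebra_simps)
    have "(root_of (signed s i) + \<gamma>) $ k \<noteq> 0" if "\<gamma> $ k \<noteq> 0" for k
    proof -
      have "cone_sign s * \<gamma> $ k \<noteq> 0" using that s by simp
      moreover have "0 \<le> cone_sign s * \<gamma> $ k" using 3 by (simp add: inner_cone_def)
      ultimately have "0 < cone_sign s * \<gamma> $ k" by linarith
      then have "0 < cone_sign s * (root_of (signed s i) + \<gamma>) $ k" unfolding * by (cases "k = i") auto
      then show ?thesis by (metis mult_zero_right less_irrefl)
    qed
    moreover have "0 \<le> cone_sign s * (root_of (signed s i) + \<gamma>) $ k" for k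
      unfolding * using 3 by (auto simp: inner_cone_def)
    ultimately have "inner_cone s (root_of (signed s i) + \<gamma>)"
      using 3 unfolding inner_cone_def by blast
    then show ?thesis by blast
  qed
next
  case (add \<gamma> x y)
  then consider "x = \<zero>\<^bsub>L\<^esub>" | "y = \<zero>\<^bsub>L\<^esub>" | "inner_cone s \<gamma>"
    | i j c d where "\<gamma> = root_of (signed s i)" "x = c \<odot>\<^bsub>L\<^esub> E (signed s i)"
        "\<gamma> = root_of (signed s j)" "y = d \<odot>\<^bsub>L\<^esub> E (signed s j)" by blast
  then show ?case
  proof cases
    case 4
    then have "x \<oplus>\<^bsub>L\<^esub> y = (c + d) \<odot>\<^bsub>L\<^esub> E (signed s i)" by (simp add: smult_add_scalar)
    then show ?thesis using 4(1) by blast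
  qed (use add nilradical_closed in auto)
next
  case (smult \<gamma> x c)
  then consider "x = \<zero>\<^bsub>L\<^esub>" | "inner_cone s \<gamma>"
    | i d where "\<gamma> = root_of (signed s i)" "x = d \<odot>\<^bsub>L\<^esub> E (signed s i)" by blast
  then show ?case
  proof cases
    case 3
    then have "c \<odot>\<^bsub>L\<^esub> x = (c * d) \<odot>\<^bsub>L\<^esub> E (signed s i)" by (simp add: smult_smult)
    then show ?thesis using 3(1) by blast
  qed auto
qed auto

lemma nilradical_cone:
  fixes \<gamma> :: "int^'n"
  assumes "nilradical s \<gamma> x" "x \<noteq> \<zero>\<^bsub>L\<^esub>"
  shows "\<gamma> \<noteq> 0" "0 \<le> cone_sign s * \<gamma> $ k"
proof -
  have s: "cone_sign s * cone_sign s = 1" "cone_sign s \<noteq> 0" by (cases s; simp)+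
  consider i where "\<gamma> = root_of (signed s i)" | "inner_cone s \<gamma>"
    using nilradical_support[OF assms(1)] assms(2) by blast
  then have "\<gamma> \<noteq> 0 \<and> 0 \<le> cone_sign s * \<gamma> $ k"
  proof cases
    case 1
    have "\<gamma> $ i \<noteq> 0" unfolding 1 root_of_signed using s by simp
    then have "\<gamma> \<noteq> 0" by auto
    then show ?thesis unfolding 1 root_of_signed using s by simp
  qed (auto simp: inner_cone_def)
  then show "\<gamma> \<noteq> 0" "0 \<le> cone_sign s * \<gamma> $ k" by auto
qed

lemma nilradical_opposite:
  assumes "nilradical True \<gamma> x" "nilradical False \<gamma> y"
  shows "x = \<zero>\<^bsub>L\<^esub> \<or> y = \<zero>\<^bsub>L\<^esub>"
proof (rule ccontr)
  assume "\<not> ?thesis"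
  then have "\<gamma> \<noteq> 0" "0 \<le> \<gamma> $ k" "\<gamma> $ k \<le> 0" for k
    using nilradical_cone[OF assms(1)] nilradical_cone[OF assms(2)] by auto
  then show False by (auto simp: vec_eq_iff intro: antisym)
qed

text \<open>A homogeneous element of a Borel subalgebra lies either in the nilradical or in the Cartan
  subalgebra, since a nonzero element of the nilradical cannot have degree \<open>0\<close>.\<close>

definition borel :: "bool \<Rightarrow> int^'n \<Rightarrow> 'n generator lie_term set \<Rightarrow> bool" where
  "borel s \<gamma> x \<longleftrightarrow> nilradical s \<gamma> x \<or> \<gamma> = 0 \<and> x \<in> range (\<lambda>h. H h)"

lemma nilradical_zero_degree: "nilradical s 0 x \<Longrightarrow> x = \<zero>\<^bsub>L\<^esub>"
  using nilradical_cone(1) by blast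

lemma cartan_add: "x \<in> range (\<lambda>h. H h) \<Longrightarrow> y \<in> range (\<lambda>h. H h) \<Longrightarrow> x \<oplus>\<^bsub>L\<^esub> y \<in> range (\<lambda>h. H h)"
  by (auto simp flip: cls_cartan_add)

lemma borel_add:
  assumes "borel s \<gamma> x" "borel s \<gamma> y" shows "borel s \<gamma> (x \<oplus>\<^bsub>L\<^esub> y)"
  using assms cartan_add nilradical_zero_degree nilradical.add unfolding borel_def
  by (metis (no_types, lifting) cls_closed imageE l_zero r_zero)

lemma borel_zero: "borel s \<gamma> \<zero>\<^bsub>L\<^esub>"
  by (simp add: borel_def nilradical.zero)

lemma borel_smult: "borel s \<gamma> x \<Longrightarrow> borel s \<gamma> (c \<odot>\<^bsub>L\<^esub> x)"
  unfolding borel_def using nilradical.smult cls_cartan_smult by blast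

text \<open>Moving a simple root vector \<open>e\<^sub>i\<close> past the factors \<open>e\<^sub>-\<^sub>j\<close> of an iterated bracket only produces
  Cartan elements, which rescale the remaining factors. That the result does not leave the opposite
  Borel subalgebra is what keeps the induction going.\<close>

lemma bracket_opposite_nilradical:
  "nilradical (\<not> s) \<gamma> y \<Longrightarrow> borel (\<not> s) (root_of (signed s i) + \<gamma>) (lie_bracket L (E (signed s i)) y)"
proof (induction rule: nilradical.induct)
  case (root j)
  show ?case
  proof (cases "i = j")
    case True
    have "lie_bracket L (E (signed s j)) (E (signed (\<not> s) j)) = H (- root_of (signed s j))"
      using bracket_opposite[of "signed s j"] by (simp add: cls_cartan_minus)
    then show ?thesis using True by (simp add: borel_def)
  next
    case False
    then show ?thesis by (simp add: bracket_mixed borel_def nilradical.zero)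
  qed
next
  case (step \<gamma> y j)
  let ?e = "E (signed s i)" and ?f = "E (signed (\<not> s) j)"
  let ?\<delta> = "root_of (signed s i) + (root_of (signed (\<not> s) j) + \<gamma>)"
  have y [simp]: "y \<in> carrier L" using step nilradical_closed by blast
  have "borel (\<not> s) ?\<delta> (lie_bracket L (lie_bracket L ?e ?f) y)"
  proof (cases "i = j")
    case True
    have "lie_bracket L ?e ?f = (- 1) \<odot>\<^bsub>L\<^esub> H (root_of (signed s i))"
      using bracket_opposite[of "signed s i"] True by simp
    moreover have \<delta>: "?\<delta> = \<gamma>"
      using True by (simp add: add.assoc[symmetric])
    ultimately show ?thesis
      using step.hyps unfolding borel_def \<delta>
      by (simp add: bracket_smult_left bracket_cartan_nilradical nilradical.smult)
  next
    case False
    then show ?thesis by (simp add: bracket_mixed borel_def nilradical.zero)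
  qed
  moreover have "borel (\<not> s) ?\<delta> (lie_bracket L ?f (lie_bracket L ?e y))"
  proof -
    consider "nilradical (\<not> s) (root_of (signed s i) + \<gamma>) (lie_bracket L ?e y)"
      | h where "root_of (signed s i) + \<gamma> = 0" "lie_bracket L ?e y = H h"
      using step.IH by (auto simp: borel_def)
    then show ?thesis
    proof cases
      case 1
      then show ?thesis using nilradical.step[OF 1, of j] by (simp add: borel_def add_ac)
    next
      case (2 h)
      have \<delta>: "?\<delta> = root_of (signed (\<not> s) j)"
        using 2(1) by (simp add: add.left_commute)
      show ?thesis
        using bracket_anti[of ?f "H h"] unfolding 2(2) borel_def \<delta>
        by (simp add: bracket_cartan_root_vec nilradical.smult nilradical.root)
    qed
  qed
  ultimately show ?case
    by (simp add: bracket_derivation[of ?e ?f y] borel_add)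
qed (simp_all add: bracket_add_right bracket_smult_right borel_zero borel_add borel_smult)

text \<open>The triangular decomposition: the homogeneous elements of the two Borel subalgebras are closed
  under brackets, so that they exhaust all homogeneous elements.\<close>

definition triangular :: "int^'n \<Rightarrow> 'n generator lie_term set \<Rightarrow> bool" where
  "triangular \<gamma> x \<longleftrightarrow> (\<exists>s. borel s \<gamma> x)"

lemma nilradical_triangular: "nilradical s \<gamma> x \<Longrightarrow> triangular \<gamma> x"
  by (auto simp: triangular_def borel_def)

lemma triangular_closed [simp]: "triangular \<gamma> x \<Longrightarrow> x \<in> carrier L"
  by (auto simp: triangular_def borel_def)

lemma triangular_add:
  assumes "triangular \<gamma> x" "triangular \<gamma> y" shows "triangular \<gamma> (x \<oplus>\<^bsub>L\<^esub> y)"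
proof -
  have L: "x \<in> carrier L" "y \<in> carrier L" using assms by simp_all
  obtain s r where sr: "borel s \<gamma> x" "borel r \<gamma> y" using assms by (auto simp: triangular_def)
  show ?thesis
  proof (cases "s = r")
    case True
    then show ?thesis using sr borel_add[of s \<gamma> x y] unfolding triangular_def by blast
  next
    case False
    have "x = \<zero>\<^bsub>L\<^esub> \<or> y = \<zero>\<^bsub>L\<^esub>" if "nilradical s \<gamma> x" "nilradical r \<gamma> y"
      using False nilradical_opposite that by (cases s; cases r) auto
    then consider "x = \<zero>\<^bsub>L\<^esub>" | "y = \<zero>\<^bsub>L\<^esub>" | "borel s \<gamma> y" | "borel r \<gamma> x"
      using sr by (auto simp: borel_def)
    then show ?thesis
    proof cases
      case 1
      then show ?thesis using assms(2) L by simp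
    next
      case 2
      then show ?thesis using assms(1) L by simp
    next
      case 3
      then show ?thesis using borel_add[OF sr(1)] by (auto simp: triangular_def)
    next
      case 4
      then show ?thesis using borel_add[OF _ sr(2)] by (auto simp: triangular_def)
    qed
  qed
qed

lemma triangular_smult: "triangular \<gamma> x \<Longrightarrow> triangular \<gamma> (c \<odot>\<^bsub>L\<^esub> x)"
  unfolding triangular_def using borel_smult by blast

lemma triangular_simple:
  assumes "triangular \<delta> y"
  shows "triangular (root_of (signed s i) + \<delta>) (lie_bracket L (E (signed s i)) y)"
proof -
  obtain r where r: "borel r \<delta> y" using assms by (auto simp: triangular_def)
  have "r = s \<or> r = (\<not> s)" by blast
  then consider "nilradical s \<delta> y" | "nilradical (\<not> s) \<delta> y" | h where "\<delta> = 0" "y = H h"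
    using r unfolding borel_def by blast
  then show ?thesis
  proof cases
    case 1
    then show ?thesis by (intro nilradical_triangular[of s] nilradical.step)
  next
    case 2
    then show ?thesis using bracket_opposite_nilradical unfolding triangular_def by blast
  next
    case (3 h)
    then show ?thesis
      using bracket_anti[of "E (signed s i)" "H h"]
      by (auto simp: bracket_cartan_root_vec intro!: nilradical_triangular[of s] nilradical.smult nilradical.root)
  qed
qed

lemma nilradical_bracket_triangular:
  "nilradical s \<gamma> x \<Longrightarrow> triangular \<delta> y \<Longrightarrow> triangular (\<gamma> + \<delta>) (lie_bracket L x y)"
proof (induction arbitrary: \<delta> y rule: nilradical.induct)
  case (root i)
  then show ?case by (rule triangular_simple)
next
  case (step \<gamma> x i)
  have "triangular (root_of (signed s i) + (\<gamma> + \<delta>)) (lie_bracket L (E (signed s i)) (lie_bracket L x y))"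
    by (rule triangular_simple[OF step.IH[OF step.prems]])
  moreover have "triangular (\<gamma> + (root_of (signed s i) + \<delta>)) (lie_bracket L x (lie_bracket L (E (signed s i)) y))"
    by (rule step.IH[OF triangular_simple[OF step.prems]])
  ultimately show ?case
    using step by (simp add: bracket_bracket_left[of "E (signed s i)" x y] add_ac
        triangular_add triangular_smult)
qed (auto simp: bracket_add_left bracket_smult_left
    intro: triangular_add triangular_smult nilradical_triangular nilradical.zero)

lemma triangular_bracket:
  assumes "triangular \<gamma> x" "triangular \<delta> y"
  shows "triangular (\<gamma> + \<delta>) (lie_bracket L x y)"
proof -
  consider s where "nilradical s \<gamma> x" | h where "\<gamma> = 0" "x = H h"
    using assms(1) by (auto simp: triangular_def borel_def)
  then show ?thesis
  proof cases
    case 1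
    then show ?thesis using assms(2) by (rule nilradical_bracket_triangular)
  next
    case (2 h)
    consider s where "nilradical s \<delta> y" | g where "y = H g"
      using assms(2) by (auto simp: triangular_def borel_def)
    then show ?thesis
    proof cases
      case 1
      then show ?thesis using 2
        by (auto simp: bracket_cartan_nilradical intro: nilradical_triangular nilradical.smult)
    next
      case (2 g)
      then show ?thesis
        by (simp add: \<open>x = H h\<close> bracket_cartan_cartan nilradical_triangular[OF nilradical.zero])
    qed
  qed
qed

lemma degree_triangular: "term_degree \<gamma> t \<Longrightarrow> triangular \<gamma> (cls t)"
proof (induction rule: term_degree.induct)
  case (cartan h)
  then show ?case by (auto simp: triangular_def borel_def)
next
  case (root_vector \<alpha>)
  then show ?case using nilradical_triangular[OF nilradical.root] by (metis signed_cases)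
qed (simp_all add: cls_simps nilradical_triangular[OF nilradical.zero] triangular_add
    triangular_smult triangular_bracket)

lemma degree_support:
  assumes "term_degree \<gamma> t" "cls t \<noteq> \<zero>\<^bsub>L\<^esub>"
  shows "\<gamma> = 0 \<or> (\<exists>\<alpha>. \<gamma> = root_of \<alpha>) \<or> (\<exists>s. inner_cone s \<gamma>)"
  using degree_triangular[OF assms(1)] assms(2) nilradical_support
  unfolding triangular_def borel_def by blast

text \<open>Integrability: by the Serre relations, the simple root vectors act locally nilpotently.\<close>

lemma ad_locally_nilpotent: "\<exists>k. (lie_bracket L (E \<alpha>) ^^ k) (cls t) = \<zero>\<^bsub>L\<^esub>"
proof (induction t)
  case (Gen x)
  obtain s i where \<alpha>: "\<alpha> = signed s i" by (rule signed_cases)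
  have h: "(lie_bracket L (E \<alpha>) ^^ 2) (H h) = \<zero>\<^bsub>L\<^esub>" for h
    using bracket_anti[of "E \<alpha>" "H h"]
    by (simp add: numeral_2_eq_2 bracket_cartan_root_vec bracket_smult_right bracket_self)
  show ?case
  proof (cases x)
    case (Cartan h)
    then show ?thesis using h by blast
  next
    case (RootVector \<gamma>)
    obtain r j where \<gamma>: "\<gamma> = signed r j" by (rule signed_cases)
    consider "r = s" "i = j" | "r = s" "i \<noteq> j" | "r = (\<not> s)" "i = j" | "r = (\<not> s)" "i \<noteq> j" by blast
    then show ?thesis
    proof cases
      case 1
      then have "(lie_bracket L (E \<alpha>) ^^ 1) (E \<gamma>) = \<zero>\<^bsub>L\<^esub>" by (simp add: \<alpha> \<gamma> bracket_self)
      then show ?thesis using RootVector by blast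
    next
      case 2
      then show ?thesis using serre[of i j s] RootVector \<alpha> \<gamma> by blast
    next
      case 3
      then have "lie_bracket L (E \<alpha>) (E \<gamma>) = H (- root_of \<alpha>)"
        using bracket_opposite[of \<alpha>] by (simp add: \<alpha> \<gamma> cls_cartan_minus)
      then have "(lie_bracket L (E \<alpha>) ^^ Suc 2) (E \<gamma>) = \<zero>\<^bsub>L\<^esub>"
        unfolding funpow_Suc_right comp_apply using h by simp
      then show ?thesis using RootVector by blast
    next
      case 4
      then have "(lie_bracket L (E \<alpha>) ^^ 1) (E \<gamma>) = \<zero>\<^bsub>L\<^esub>" by (simp add: \<alpha> \<gamma> bracket_mixed)
      then show ?thesis using RootVector by blast
    qed
  qed
next
  case Zero
  have "(lie_bracket L (E \<alpha>) ^^ 0) (cls Zero) = \<zero>\<^bsub>L\<^esub>" by (simp add: cls_simps)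
  then show ?case by blast
next
  case (Plus s t)
  then obtain m n where "(lie_bracket L (E \<alpha>) ^^ m) (cls s) = \<zero>\<^bsub>L\<^esub>" "(lie_bracket L (E \<alpha>) ^^ n) (cls t) = \<zero>\<^bsub>L\<^esub>"
    by blast
  then have "(lie_bracket L (E \<alpha>) ^^ max m n) (cls (Plus s t)) = \<zero>\<^bsub>L\<^esub>"
    using ad_power_zero_mono[OF _ max.cobounded1[of m n]] ad_power_zero_mono[OF _ max.cobounded2[of n m]]
    by (simp add: cls_simps ad_power_add)
  then show ?case by blast
next
  case (Scale c t)
  then obtain m where "(lie_bracket L (E \<alpha>) ^^ m) (cls t) = \<zero>\<^bsub>L\<^esub>" by blast
  then have "(lie_bracket L (E \<alpha>) ^^ m) (cls (Scale c t)) = \<zero>\<^bsub>L\<^esub>" by (simp add: cls_simps ad_power_smult)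
  then show ?case by blast
next
  case (Bracket s t)
  then obtain m n where "(lie_bracket L (E \<alpha>) ^^ m) (cls s) = \<zero>\<^bsub>L\<^esub>" "(lie_bracket L (E \<alpha>) ^^ n) (cls t) = \<zero>\<^bsub>L\<^esub>"
    by blast
  then have "(lie_bracket L (E \<alpha>) ^^ (m + n)) (cls (Bracket s t)) = \<zero>\<^bsub>L\<^esub>"
    using ad_nilpotent_bracket[of "E \<alpha>" "cls s" "cls t" m n] by (simp add: cls_simps)
  then show ?case by blast
qed

lemma term_degree_ad_power:
  "term_degree \<gamma> t \<Longrightarrow> term_degree (\<gamma> + of_nat n *s root_of \<alpha>) ((Bracket (root_vec \<alpha>) ^^ n) t)"
proof (induction n)
  case (Suc n)
  have "root_of \<alpha> + (\<gamma> + of_nat n *s root_of \<alpha>) = \<gamma> + of_nat (Suc n) *s root_of \<alpha>"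
    by (simp add: vec_eq_iff algebra_simps)
  then show ?case
    using term_degree.bracket[OF term_degree.root_vector[of \<alpha>] Suc.IH[OF Suc.prems]]
    by (simp only: funpow.simps comp_apply)
qed simp

text \<open>The set of degrees that occur is stable under simple reflections: the \<open>m\<close>th power of
  \<open>ad e\<^sub>-\<^sub>\<alpha>\<close> maps the degree \<open>\<gamma>\<close> to its reflection, and it is injective there since the weight for
  \<open>\<alpha>\<^sup>\<or>\<close> is \<open>m\<close>.\<close>

lemma reflection_vanishing:
  assumes m: "form B \<gamma> (root_of \<alpha>) = int m"
    and van: "\<And>u. term_degree (\<gamma> - int m *s root_of \<alpha>) u \<Longrightarrow> cls u = \<zero>\<^bsub>L\<^esub>"
    and t: "term_degree \<gamma> t"
  shows "cls t = \<zero>\<^bsub>L\<^esub>"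
proof -
  obtain k where k: "(lie_bracket L (E \<alpha>) ^^ k) (cls t) = \<zero>\<^bsub>L\<^esub>" using ad_locally_nilpotent by blast
  have aa: "form B (root_of \<alpha>) (root_of \<alpha>) = (2::complex)"
    by (cases \<alpha>) (simp_all add: form_linear form_axis B_diag)
  have "\<gamma> + of_nat m *s root_of (opposite \<alpha>) = \<gamma> - int m *s root_of \<alpha>"
    by (simp add: vec_eq_iff)
  then have "cls ((Bracket (root_vec (opposite \<alpha>)) ^^ m) t) = \<zero>\<^bsub>L\<^esub>"
    using term_degree_ad_power[OF t, of m "opposite \<alpha>"] van by simp
  then have f: "(lie_bracket L (E (opposite \<alpha>)) ^^ m) (cls t) = \<zero>\<^bsub>L\<^esub>"
    by (simp add: cls_ad_power)
  have "form B (root_of \<alpha>) (cast_vec \<gamma>) = (of_int (form B (root_of \<alpha>) \<gamma>) :: complex)"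
    using form_cast_vec[of B "root_of \<alpha>" \<gamma>] by simp
  then have w: "lie_bracket L (H (root_of \<alpha>)) (cls t) = of_nat m \<odot>\<^bsub>L\<^esub> cls t"
    using bracket_cartan_degree[OF t, of "root_of \<alpha>"] m by (simp add: form_commute[OF IM_B, of "root_of \<alpha>"])
  show ?thesis
    using sl2_lowering_injective[OF _ _ _ _ _ _ _ w k f] bracket_opposite[of \<alpha>]
    by (simp add: bracket_cartan_root_vec aa form_linear)
qed

text \<open>A degree \<open>\<gamma>\<close> of norm larger than \<open>2\<close> that occurs would lie in the positive or the negative cone
  and have two nonzero coordinates. As its norm is positive, some coordinate of \<open>\<gamma>\<close> and the inner
  product of \<open>\<gamma>\<close> with the corresponding simple root have the same sign. The reflection in this root
  either makes \<open>\<gamma>\<close> smaller, or it leads to a vector with coordinates of both signs, which is not the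
  degree of any nonzero element.\<close>

lemma norm_vanishing:
  assumes "form B \<gamma> \<gamma> > 2" "term_degree \<gamma> t"
  shows "cls t = \<zero>\<^bsub>L\<^esub>"
  using assms
proof (induction "nat (\<Sum>k\<in>UNIV. \<bar>\<gamma> $ k\<bar>)" arbitrary: \<gamma> t rule: less_induct)
  case less
  have root_norm: "form B (root_of \<alpha>) (root_of \<alpha>) = (2::int)" for \<alpha>
    by (cases \<alpha>) (simp_all add: form_linear form_axis B_diag)
  show ?case
  proof (rule ccontr)
    assume "cls t \<noteq> \<zero>\<^bsub>L\<^esub>"
    then obtain s where s: "inner_cone s \<gamma>"
      using degree_support[OF less.prems(2)] less.prems(1) root_norm by fastforce
    have ss: "cone_sign s * cone_sign s = 1" "cone_sign s = 1 \<or> cone_sign s = - 1" by (cases s; simp)+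
    have rs: "root_of (signed s k) = cone_sign s *s (axis k 1 :: int^'n)" for k
      by (cases s) (simp_all add: vec_eq_iff)
    have cancel: "(cone_sign s * x) * (cone_sign s * y) = x * y" for x y
      using ss(2) by auto
    have expand: "form B \<gamma> \<gamma> = (\<Sum>k\<in>UNIV. (cone_sign s * \<gamma> $ k) * form B (root_of (signed s k)) \<gamma>)"
      unfolding rs form_smult_left cancel by (rule form_expand_left)
    have "\<exists>k. (cone_sign s * \<gamma> $ k) * form B (root_of (signed s k)) \<gamma> > 0"
    proof (rule ccontr)
      assume "\<not> ?thesis"
      then have "form B \<gamma> \<gamma> \<le> 0" unfolding expand by (intro sum_nonpos) (simp add: not_less)
      then show False using less.prems(1) by simp
    qed
    then obtain k where k: "(cone_sign s * \<gamma> $ k) * form B (root_of (signed s k)) \<gamma> > 0" by blast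
    moreover have "0 \<le> cone_sign s * \<gamma> $ k" using s by (simp add: inner_cone_def)
    ultimately have k1: "0 < cone_sign s * \<gamma> $ k" and k2: "0 < form B (root_of (signed s k)) \<gamma>"
      by (auto simp: zero_less_mult_iff)
    let ?\<alpha> = "signed s k"
    define m where "m = nat (form B \<gamma> (root_of ?\<alpha>))"
    have m: "form B \<gamma> (root_of ?\<alpha>) = int m" "0 < m"
      using k2 form_commute[OF IM_B, of \<gamma>] by (simp_all add: m_def)
    define \<delta> where "\<delta> = \<gamma> - int m *s root_of ?\<alpha>"
    have \<delta>: "\<delta> $ l = (if l = k then \<gamma> $ k - int m * cone_sign s else \<gamma> $ l)" for l
      unfolding \<delta>_def vector_minus_component vector_smult_component root_of_signed by simp
    have norm: "form B \<delta> \<delta> = form B \<gamma> \<gamma>"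
      using m(1) form_commute[OF IM_B, of "root_of ?\<alpha>" \<gamma>]
      by (simp add: \<delta>_def form_linear root_norm algebra_simps)
    have "cls u = \<zero>\<^bsub>L\<^esub>" if u: "term_degree \<delta> u" for u
    \<comment> \<open>The reflection changes the \<open>k\<close>th coordinate only, so that this one decides whether it leaves the cone.\<close>
    proof (cases "0 \<le> cone_sign s * \<delta> $ k")
      case True
      have "(\<Sum>l\<in>UNIV. \<bar>\<delta> $ l\<bar>) < (\<Sum>l\<in>UNIV. \<bar>\<gamma> $ l\<bar>)"
      proof (rule sum_strict_mono_ex1)
        show "\<exists>l\<in>UNIV. \<bar>\<delta> $ l\<bar> < \<bar>\<gamma> $ l\<bar>"
          using True k1 m(2) ss by (intro bexI[of _ k]) (auto simp: \<delta>)
        show "\<forall>l\<in>UNIV. \<bar>\<delta> $ l\<bar> \<le> \<bar>\<gamma> $ l\<bar>"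
          using True k1 m(2) ss by (auto simp: \<delta>)
      qed simp
      moreover have "0 \<le> (\<Sum>l\<in>UNIV. \<bar>\<delta> $ l\<bar>)" by (simp add: sum_nonneg)
      ultimately have "nat (\<Sum>l\<in>UNIV. \<bar>\<delta> $ l\<bar>) < nat (\<Sum>l\<in>UNIV. \<bar>\<gamma> $ l\<bar>)" by linarith
      then show ?thesis
        using less.prems(1) norm u by (intro less.hyps[of \<delta>]) simp_all
    next
      case False
      obtain l where l: "l \<noteq> k" "\<gamma> $ l \<noteq> 0" using s unfolding inner_cone_def by metis
      then have "0 < cone_sign s * \<delta> $ l" using s ss by (auto simp: inner_cone_def \<delta> order_less_le)
      with False have no: "\<not> inner_cone r \<delta>" for r
        using ss by (cases r) (auto simp: inner_cone_def not_le dest!: spec[of _ k] spec[of _ l])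
      show ?thesis
        using degree_support[OF u] no norm less.prems(1) root_norm by fastforce
    qed
    then show False
      using reflection_vanishing[OF m(1) _ less.prems(2)] \<open>cls t \<noteq> \<zero>\<^bsub>L\<^esub>\<close> by (simp add: \<delta>_def)
  qed
qed

lemma kac_moody_relations_in_IM:
  assumes "(s, t) \<in> kac_moody_relations B"
  shows "(s, t) \<in> IM_relations B"
proof -
  have neg: "B $ i $ j \<le> 0" if "i \<noteq> j" for i j
    using gcm that by (simp add: symmetric_generalized_cartan_matrix_def)
  have sym: "B $ i $ j = B $ j $ i" for i j by (rule intersection_matrix_sym[OF IM_B])
  have mixed: "(Bracket (root_vec (Pos i)) (root_vec (Neg j)), Zero) \<in> IM_relations B" if "i \<noteq> j" for i j
  proof -
    have "term_degree (root_of (Pos i) + root_of (Neg j)) (Bracket (root_vec (Pos i)) (root_vec (Neg j)))"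
      by (intro term_degree.intros)
    moreover have "form B (root_of (Pos i) + root_of (Neg j)) (root_of (Pos i) + root_of (Neg j)) > (2::int)"
      using neg[OF that] sym[of i j] by (simp add: form_linear form_axis B_diag)
    ultimately show ?thesis unfolding IM_relations_def by blast
  qed
  have serre: "((Bracket (root_vec (signed s i)) ^^ nat (1 - B $ i $ j)) (root_vec (signed s j)), Zero) \<in> IM_relations B"
    if "i \<noteq> j" for s i j
  proof -
    let ?n = "nat (1 - B $ i $ j)"
    let ?\<gamma> = "root_of (signed s j) + of_nat ?n *s root_of (signed s i) :: int^'n"
    have "term_degree ?\<gamma> ((Bracket (root_vec (signed s i)) ^^ ?n) (root_vec (signed s j)))"
      by (intro term_degree_ad_power term_degree.intros)
    moreover have n: "int ?n = 1 - B $ i $ j" using neg[OF that] by simp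
    have "form B ?\<gamma> ?\<gamma> = 2 + 2 * int ?n * B $ i $ j + 2 * int ?n * int ?n"
      using sym[of i j] by (cases s) (simp_all add: form_linear form_axis B_diag algebra_simps)
    then have "form B ?\<gamma> ?\<gamma> = 2 + 2 * (1 - B $ i $ j)"
      unfolding n by (simp add: algebra_simps)
    then have "form B ?\<gamma> ?\<gamma> > 2" using neg[OF that] by simp
    ultimately show ?thesis unfolding IM_relations_def by blast
  qed
  consider "(s, t) \<in> tilde_relations B"
    | i j where "i \<noteq> j" "s = Bracket (root_vec (Pos i)) (root_vec (Neg j))" "t = Zero"
    | i j where "i \<noteq> j" "t = Zero"
        "s = (Bracket (root_vec (signed True i)) ^^ nat (1 - B $ i $ j)) (root_vec (signed True j))"
    | i j where "i \<noteq> j" "t = Zero"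
        "s = (Bracket (root_vec (signed False i)) ^^ nat (1 - B $ i $ j)) (root_vec (signed False j))"
    using assms unfolding kac_moody_relations_def by auto
  then show ?thesis
  proof cases
    case 1
    then show ?thesis by (simp add: IM_relations_def)
  next
    case (2 i j)
    then show ?thesis using mixed by blast
  next
    case (3 i j)
    then show ?thesis using serre[of i j True] by blast
  next
    case (4 i j)
    then show ?thesis using serre[of i j False] by blast
  qed
qed

lemma presented_IM_eq_kac_moody: "presented_lie_algebra (IM_relations B) = kac_moody_algebra B"
proof -
  have "lie_cong (IM_relations B \<union> kac_moody_relations B) = lie_cong (IM_relations B)"
    using kac_moody_relations_in_IM by (intro lie_cong_redundant) (auto intro: lie_cong.rel)
  moreover have "lie_cong (IM_relations B \<union> kac_moody_relations B) = lie_cong (kac_moody_relations B)"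
  proof (rule lie_cong_redundant)
    fix s t assume "(s, t) \<in> IM_relations B \<union> kac_moody_relations B"
    then consider "(s, t) \<in> kac_moody_relations B"
      | \<gamma> where "t = Zero" "form B \<gamma> \<gamma> > 2" "term_degree \<gamma> s"
      by (auto simp: IM_relations_def kac_moody_relations_def)
    then show "lie_cong (kac_moody_relations B) s t"
    proof cases
      case (2 \<gamma>)
      then show ?thesis
        using norm_vanishing unfolding lie_class_eq[symmetric] by (simp add: cls_simps)
    qed (rule lie_cong.rel)
  qed simp
  ultimately show ?thesis
    by (simp add: kac_moody_algebra_def presented_lie_algebra_def lie_class_def)
qed

end


section \<open>Positive semidefinite intersection matrices of corank at most one\<close>

lemma finite_bounded_vec:
  assumes "finite S" shows "finite {x :: 'a^'n. \<forall>k. x $ k \<in> S}"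
proof (rule finite_subset)
  show "{x :: 'a^'n. \<forall>k. x $ k \<in> S} \<subseteq> vec_lambda ` (PiE UNIV (\<lambda>_. S))"
  proof
    fix x :: "'a^'n" assume "x \<in> {x. \<forall>k. x $ k \<in> S}"
    then have "x = vec_lambda (\<lambda>k. x $ k)" "(\<lambda>k. x $ k) \<in> PiE UNIV (\<lambda>_. S)" by auto
    then show "x \<in> vec_lambda ` (PiE UNIV (\<lambda>_. S))" by blast
  qed
qed (simp add: assms finite_PiE)

lemma positive_semidefinite_int:
  fixes x :: "int^'n"
  assumes "positive_semidefinite A" shows "0 \<le> form A x x"
proof -
  have "0 \<le> form A (cast_vec x :: real^'n) (cast_vec x)"
    using assms by (simp add: positive_semidefinite_def)
  then show ?thesis by (simp add: form_cast_vec)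
qed

definition in_radical :: "int^'n^'n \<Rightarrow> int^'n \<Rightarrow> bool" where
  "in_radical A x \<longleftrightarrow> (\<forall>y::int^'n. form A x y = 0)"

lemma in_radical_linear:
  "in_radical A x \<Longrightarrow> in_radical A y \<Longrightarrow> in_radical A (x - y)"
  "in_radical A x \<Longrightarrow> in_radical A (m *s x)"
  by (simp_all add: in_radical_def form_linear)

text \<open>A semidefinite form obeys the Cauchy-Schwarz inequality; the multiple of \<open>x\<close> in the proof is
  large enough for \<open>(x, y) \<noteq> 0\<close> to make the norm of its sum with \<open>y\<close> negative.\<close>

lemma null_vector_in_radical:
  fixes x :: "int^'n"
  assumes A: "intersection_matrix A" "positive_semidefinite A" and x: "form A x x = 0"
  shows "in_radical A x"
  unfolding in_radical_def
proof (rule ccontr)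
  assume "\<not> (\<forall>y::int^'n. form A x y = 0)"
  then obtain y :: "int^'n" where y: "form A x y \<noteq> 0" by blast
  let ?b = "form A x y" and ?q = "form A y y"
  have "0 \<le> form A ((- (?q + 1) * ?b) *s x + y) ((- (?q + 1) * ?b) *s x + y)"
    by (rule positive_semidefinite_int[OF A(2)])
  also have "\<dots> = ?q - 2 * (?q + 1) * (?b * ?b)"
    using x form_commute[OF A(1), of y x] by (simp add: form_linear algebra_simps)
  finally have "2 * (?q + 1) * (?b * ?b) \<le> ?q" by simp
  moreover have "0 \<le> ?q" by (rule positive_semidefinite_int[OF A(2)])
  moreover have "1 \<le> ?b * ?b"
    using y by (metis zero_less_mult_iff linorder_neqE_linordered_idom int_one_le_iff_zero_less)
  ultimately have "0 \<le> ?q" "2 * (?q + 1) * (?b * ?b) \<le> ?q" "2 * (?q + 1) * 1 \<le> 2 * (?q + 1) * (?b * ?b)"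
    by (simp_all add: mult_left_mono del: mult_1_right)
  then have "2 * (?q + 1) * 1 \<le> ?q" by (meson order_trans)
  then show False using \<open>0 \<le> ?q\<close> by simp
qed

lemma inner_product_bound:
  fixes x y :: "int^'n"
  assumes A: "intersection_matrix A" "positive_semidefinite A"
    and "form A x x = 2" "form A y y = 2"
  shows "form A x y \<in> {-2..2}"
  using positive_semidefinite_int[OF A(2), of "x + y"] positive_semidefinite_int[OF A(2), of "x - y"]
    form_commute[OF A(1), of y x] assms(3,4)
  by (simp add: form_linear)

text \<open>The row space of \<open>A\<close> together with one vector \<open>v\<close> spans everything, so that the combination
  of \<open>x\<close> and \<open>y\<close> that is orthogonal to \<open>v\<close> vanishes.\<close>

lemma radical_proportional:
  fixes A :: "int^'n^'n" and x y :: "int^'n"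
  assumes A: "intersection_matrix A" and corank: "corank A \<le> 1"
    and x: "in_radical A x" and y: "in_radical A y"
  shows "x $ k * y $ l = x $ l * y $ k"
proof -
  define M where "M = map_matrix rat_of_int A"
  define dot where "dot u w = (\<Sum>i\<in>UNIV. u $ i * w $ i)" for u w :: "rat^'n"
  have dot_lin: "dot u (w + z) = dot u w + dot u z" "dot u (c *s w) = c * dot u w"
      "dot (u - v) w = dot u w - dot v w" "dot (c *s u) w = c * dot u w" "dot u 0 = 0" for u v w z c
    by (simp_all add: dot_def algebra_simps sum.distrib sum_distrib_left sum_subtractf)
  have dot_axis: "dot u (axis i 1) = u $ i" for u i
  proof -
    have "dot u (axis i 1) = (\<Sum>l\<in>UNIV. if l = i then u $ i else 0)"
      unfolding dot_def by (rule sum.cong) (auto simp: axis_def)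
    then show ?thesis by simp
  qed
  have rows: "dot (cast_vec z) r = 0" if z: "in_radical A z" and r: "r \<in> rows M" for z r
  proof -
    obtain i where r: "r = row i M" using r by (auto simp: rows_def)
    have "dot (cast_vec z) r = of_int (form A (axis i 1) z)"
      by (simp add: r dot_def row_def M_def form_axis_left mult.commute)
    then show ?thesis using z form_commute[OF A, of "axis i 1" z] by (simp add: in_radical_def)
  qed
  have "\<exists>v. vec.span (insert v (rows M)) = UNIV"
  proof (cases "vec.span (rows M) = UNIV")
    case True
    then show ?thesis using vec.span_mono[of "rows M" "insert 0 (rows M)"] by blast
  next
    case False
    then obtain v where v: "v \<notin> vec.span (rows M)" by blast
    have "CARD('n) \<le> vec.dim (rows M) + 1"
      using corank by (simp add: corank_def row_rank_def_gen M_def)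
    also have "\<dots> = vec.dim (insert v (rows M))" using v by (simp add: vec.dim_insert)
    finally have "vec.dim (insert v (rows M)) = vec.dimension TYPE(rat) TYPE('n)"
      using vec.dim_subset_UNIV[of "insert v (rows M)"] by (simp add: vec.dimension_def card_cart_basis)
    then show ?thesis using vec.dim_eq_full[of "insert v (rows M)"] by blast
  qed
  then obtain v where v: "vec.span (insert v (rows M)) = UNIV" by blast
  have zero: "u = 0" if u: "dot u v = 0" "\<And>r. r \<in> rows M \<Longrightarrow> dot u r = 0" for u
  proof -
    have "dot u w = 0" if "w \<in> vec.span (insert v (rows M))" for w
      using that
    proof (induction rule: vec.span_induct)
      case base
      show ?case by (auto simp: vec.subspace_def dot_lin)
    qed (use u in auto)
    then show "u = 0" unfolding v by (metis UNIV_I dot_axis vec_eq_iff zero_index)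
  qed
  let ?X = "cast_vec x :: rat^'n" and ?Y = "cast_vec y :: rat^'n"
  let ?a = "dot ?Y v" and ?b = "dot ?X v"
  have "?a *s ?X - ?b *s ?Y = 0"
    by (rule zero) (simp_all add: dot_lin rows[OF x] rows[OF y])
  then have "(?a *s ?X - ?b *s ?Y) $ i = 0" for i by simp
  then have eq: "?a * ?X $ i = ?b * ?Y $ i" for i by simp
  have "?X $ k * ?Y $ l = ?X $ l * ?Y $ k"
  proof (cases "?a = 0 \<and> ?b = 0")
    case True
    then have "?X = 0" by (intro zero) (simp_all add: rows[OF x])
    then have "?X $ i = 0" for i by simp
    then show ?thesis by simp
  next
    case False
    have "?a * (?X $ k * ?Y $ l) = (?a * ?X $ k) * ?Y $ l" by simp
    also have "\<dots> = (?b * ?Y $ l) * ?Y $ k" unfolding eq[of k] by simp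
    also have "\<dots> = ?a * (?X $ l * ?Y $ k)" unfolding eq[of l, symmetric] by simp
    finally have "?a * (?X $ k * ?Y $ l) = ?a * (?X $ l * ?Y $ k)" .
    moreover have "?b * (?X $ k * ?Y $ l) = ?b * (?X $ l * ?Y $ k)"
    proof -
      have "?b * (?X $ k * ?Y $ l) = ?X $ k * (?b * ?Y $ l)" by simp
      also have "\<dots> = ?X $ l * (?a * ?X $ k)" unfolding eq[of l, symmetric] by simp
      also have "\<dots> = ?b * (?X $ l * ?Y $ k)" unfolding eq[of k] by simp
      finally show ?thesis .
    qed
    ultimately show ?thesis using False by auto
  qed
  then have "rat_of_int (x $ k * y $ l) = rat_of_int (x $ l * y $ k)" by simp
  then show ?thesis by (simp only: of_int_eq_iff)
qed

text \<open>If the form is nondegenerate, then \<open>d = 0\<close>; in this way both coranks are treated alike.\<close>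

definition radical_generator :: "int^'n^'n \<Rightarrow> int^'n \<Rightarrow> bool" where
  "radical_generator A d \<longleftrightarrow> in_radical A d \<and> (\<forall>x. in_radical A x \<longrightarrow> (\<exists>m. x = m *s d))"

text \<open>Division with remainder by a radical vector whose \<open>i\<close>th coordinate is minimal and nonzero leaves
  a radical vector with \<open>i\<close>th coordinate \<open>0\<close>, which vanishes by proportionality.\<close>

lemma radical_generator_exists:
  fixes A :: "int^'n^'n"
  assumes A: "intersection_matrix A" and corank: "corank A \<le> 1"
  shows "\<exists>d. radical_generator A d"
proof (cases "\<exists>x. in_radical A x \<and> x \<noteq> 0")
  case False
  then have "radical_generator A 0"
    unfolding radical_generator_def by (metis form_zero(1) in_radical_def vector_smult_rzero)
  then show ?thesis by blast
next
  case True
  then obtain x0 :: "int^'n" and i where x0: "in_radical A x0" "x0 $ i \<noteq> 0" by (auto simp: vec_eq_iff)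
  define P where "P x \<longleftrightarrow> in_radical A x \<and> x $ i \<noteq> 0" for x
  obtain d where d: "P d" and min: "\<And>x. P x \<Longrightarrow> nat \<bar>d $ i\<bar> \<le> nat \<bar>x $ i\<bar>"
    using x0 exists_least_iff[of "\<lambda>n. \<exists>x. P x \<and> nat \<bar>x $ i\<bar> = n"]
    by (metis P_def leI)
  have "\<exists>m. x = m *s d" if x: "in_radical A x" for x
  proof
    define r where "r = x - (x $ i div d $ i) *s d"
    have r: "in_radical A r" using x d by (simp add: P_def in_radical_linear r_def)
    have ri: "r $ i = x $ i mod d $ i" by (simp add: r_def minus_div_mult_eq_mod)
    have "\<bar>r $ i\<bar> < \<bar>d $ i\<bar>" unfolding ri using d by (simp add: P_def abs_mod_less)
    then have r0: "r $ i = 0" using min[of r] r by (fastforce simp: P_def)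
    have "d $ i * r $ k = 0" for k
      using radical_proportional[OF A corank _ r, of d k i] d r0 by (simp add: P_def)
    then have "r = 0" using d by (simp add: P_def vec_eq_iff)
    then show "x = (x $ i div d $ i) *s d" by (simp add: r_def)
  qed
  then show ?thesis using d by (auto simp: radical_generator_def P_def)
qed

lemma radical_generator_gram:
  assumes d: "radical_generator A d"
    and PQ: "\<And>x::int^'n. change_vec P (change_vec Q x) = x" "\<And>x::int^'n. change_vec Q (change_vec P x) = x"
  shows "radical_generator (gram A P) (change_vec Q d)"
proof -
  have *: "in_radical (gram A P) x \<longleftrightarrow> in_radical A (change_vec P x)" for x
    unfolding in_radical_def form_gram by (metis PQ(1))
  show ?thesis
    unfolding radical_generator_def *
    using d PQ by (metis change_vec_linear(2) radical_generator_def of_int_eq_id id_apply)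
qed

lemma positive_semidefinite_gram:
  "positive_semidefinite A \<Longrightarrow> positive_semidefinite (gram A P)"
  by (simp add: positive_semidefinite_def form_gram)

text \<open>The matrices that occur in the reduction belong to bases of the same lattice for which the
  generator of the radical has nonnegative coordinates, such as the marks of an affine diagram.\<close>

definition admissible :: "int^'n^'n \<Rightarrow> int^'n \<Rightarrow> bool" where
  "admissible A d \<longleftrightarrow> intersection_matrix A \<and> positive_semidefinite A \<and>
     radical_generator A d \<and> (\<forall>k. 0 \<le> d $ k)"

text \<open>Two generators of the radical differ by a sign.\<close>

lemma admissible_unique:
  assumes "admissible A d" "admissible A d'" shows "d = d'"
proof (cases "d = 0 \<or> d' = 0")
  case True
  obtain m n where "d' = m *s d" "d = n *s d'"
    using assms unfolding admissible_def radical_generator_def by metis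
  then show ?thesis using True by auto
next
  case False
  obtain m n where mn: "d' = m *s d" "d = n *s d'"
    using assms unfolding admissible_def radical_generator_def by metis
  obtain k where k: "d $ k \<noteq> 0" using False by (auto simp: vec_eq_iff)
  have dk: "0 < d $ k" "0 \<le> d' $ k" using assms k by (auto simp: admissible_def order_less_le)
  have e1: "d' $ k = m * d $ k" using mn(1) by simp
  have e2: "d $ k = n * d' $ k" using arg_cong[OF mn(2), of "\<lambda>v. v $ k"] by simp
  have "(n * m) * d $ k = 1 * d $ k" using e1 e2 by (simp add: mult.assoc)
  then have "n * m = 1" using k by (simp only: mult_cancel_right) simp
  moreover have "0 \<le> m" using e1 dk by (simp add: zero_le_mult_iff)
  ultimately have "m = 1" by (metis zmult_eq_1_iff mult.commute zero_le_one not_one_le_zero linorder_not_le neg_0_le_iff_le)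
  then show ?thesis using mn(1) by simp
qed

text \<open>The entries of \<open>A\<close> are bounded, and \<open>d\<close> is determined by \<open>A\<close>.\<close>

lemma finite_admissible: "finite {p :: (int^'n^'n) \<times> (int^'n). admissible (fst p) (snd p)}" (is "finite ?S")
proof (rule finite_imageD)
  have "A $ i $ j \<in> {-2..2}" if "admissible A d" for A :: "int^'n^'n" and d i j
  proof -
    have A: "intersection_matrix A" "positive_semidefinite A" using that by (auto simp: admissible_def)
    then have "form A (axis i 1) (axis j 1) \<in> {-2..2::int}"
      by (intro inner_product_bound) (simp_all add: form_axis intersection_matrix_def)
    then show ?thesis by (simp add: form_axis)
  qed
  then have "fst ` ?S \<subseteq> {A. \<forall>i. A $ i \<in> {x. \<forall>j. x $ j \<in> {-2..2}}}" by fastforce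
  then show "finite (fst ` ?S)"
    by (rule finite_subset) (intro finite_bounded_vec, simp)
  show "inj_on fst ?S" using admissible_unique by (fastforce intro!: inj_onI)
qed

text \<open>As \<open>x\<close> and \<open>d\<close> have nonnegative coordinates, the last condition means that \<open>x\<close> is supported on
  the simple roots that do not occur in \<open>d\<close>.\<close>

definition transversal_roots :: "int^'n^'n \<Rightarrow> int^'n \<Rightarrow> (int^'n) set" where
  "transversal_roots A d = {x. (\<forall>k. 0 \<le> x $ k) \<and> form A x x = 2 \<and> (\<Sum>k\<in>UNIV. d $ k * x $ k) = 0}"

text \<open>A vector is determined modulo the radical by its inner products with the simple roots. For a
  vector of norm \<open>2\<close> these are bounded, and the condition on \<open>d\<close> excludes two vectors that differ by
  a multiple of \<open>d\<close>.\<close>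

lemma finite_transversal_roots:
  assumes ad: "admissible A d" shows "finite (transversal_roots A d)"
proof (rule finite_imageD)
  have A: "intersection_matrix A" "positive_semidefinite A" and gen: "radical_generator A d"
    using ad by (auto simp: admissible_def)
  let ?f = "\<lambda>x. \<chi> k. form A x (axis k 1 :: int^'a)"
  have "?f x $ k \<in> {-2..2}" if "x \<in> transversal_roots A d" for x k
    using that A unfolding transversal_roots_def vec_lambda_beta
    by (intro inner_product_bound) (simp_all add: form_axis intersection_matrix_def)
  then have "?f ` transversal_roots A d \<subseteq> {y. \<forall>k. y $ k \<in> {-2..2}}" by blast
  then show "finite (?f ` transversal_roots A d)"
    by (rule finite_subset) (intro finite_bounded_vec, simp)
  show "inj_on ?f (transversal_roots A d)"
  proof (rule inj_onI)
    fix x y assume xy: "x \<in> transversal_roots A d" "y \<in> transversal_roots A d" "?f x = ?f y"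
    have "form A (x - y) (axis k 1) = 0" for k
      using xy(3) by (simp add: vec_eq_iff form_linear)
    then have "form A (x - y) z = 0" for z
      using form_expand_left[of A z "x - y"] form_commute[OF A(1), of "x - y"] by simp
    then obtain m where m: "x - y = m *s d"
      using gen unfolding radical_generator_def in_radical_def by blast
    have "m * (\<Sum>k\<in>UNIV. d $ k * d $ k) = (\<Sum>k\<in>UNIV. d $ k * (x - y) $ k)"
      unfolding m by (simp add: sum_distrib_left mult_ac)
    also have "\<dots> = 0"
      using xy(1,2) by (simp add: transversal_roots_def algebra_simps sum_subtractf)
    finally have "m = 0 \<or> (\<Sum>k\<in>UNIV. d $ k * d $ k) = 0" by simp
    then have "m = 0 \<or> d = 0" by (auto simp: sum_nonneg_eq_0_iff vec_eq_iff)
    then show "x = y" using m by auto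
  qed
qed

text \<open>An admissible basis has no inner products \<open>2\<close>: the difference of two such simple roots would be
  a null vector with coordinates of both signs.\<close>

lemma admissible_positive_entry:
  fixes A :: "int^'n^'n"
  assumes ad: "admissible A d" and ij: "i \<noteq> j" and pos: "A $ i $ j > 0"
  shows "A $ i $ j = 1"
proof -
  have A: "intersection_matrix A" "positive_semidefinite A" and gen: "radical_generator A d"
    and nn: "\<And>k. 0 \<le> d $ k" using ad by (auto simp: admissible_def)
  have diag: "A $ k $ k = 2" for k using A(1) by (simp add: intersection_matrix_def)
  have "form A (axis i 1) (axis j 1) \<in> {-2..2::int}"
    using A by (intro inner_product_bound) (simp_all add: form_axis diag)
  then have "A $ i $ j \<le> 2" by (simp add: form_axis)
  moreover have "A $ i $ j \<noteq> 2"
  proof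
    assume 2: "A $ i $ j = 2"
    let ?x = "axis i 1 - axis j 1 :: int^'n"
    have "form A ?x ?x = 0"
      using 2 intersection_matrix_sym[OF A(1), of i j] by (simp add: form_linear form_axis diag)
    then obtain m where m: "?x = m *s d"
      using null_vector_in_radical[OF A] gen unfolding radical_generator_def by blast
    have "?x $ i = m * d $ i" "?x $ j = m * d $ j" unfolding m by simp_all
    then have "1 = m * d $ i" "- 1 = m * d $ j" using ij by (simp_all add: axis_def)
    then show False using nn[of i] nn[of j] by (smt (verit) mult_nonneg_nonneg mult_nonpos_nonneg)
  qed
  ultimately show ?thesis using pos by simp
qed

lemma admissible_flip:
  assumes A: "intersection_matrix A" "positive_semidefinite A" and d: "radical_generator A d"
  shows "admissible (gram A (flip_matrix {k. d $ k < 0})) (change_vec (flip_matrix {k. d $ k < 0}) d)"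
  unfolding admissible_def
  using intersection_matrix_flip[OF A(1)] positive_semidefinite_gram[OF A(2)]
    radical_generator_gram[OF d flip_flip flip_flip]
  by (simp add: change_vec_flip)

context
  fixes A :: "int^'n^'n" and d i j
  assumes ad: "admissible A d" and sh: "shear A i j 1"
begin

interpretation shear A i j 1 by (rule sh)

lemma sheared_generator: "change_vec (shear_matrix i j (- 1)) d $ k = (if k = i then d $ i + d $ j else d $ k)"
  by (simp add: change_vec_shear)

lemma admissible_shear: "admissible (gram A (shear_matrix i j 1)) (change_vec (shear_matrix i j (- 1)) d)"
proof -
  have "radical_generator (gram A (shear_matrix i j 1)) (change_vec (shear_matrix i j (- 1)) d)"
    using ad ij by (intro radical_generator_gram) (auto simp: admissible_def shear_shear shear_shear')
  then show ?thesis
    using ad intersection_matrix_shear positive_semidefinite_gram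
    by (auto simp: admissible_def sheared_generator)
qed

lemma sum_sheared_generator: "(\<Sum>k\<in>UNIV. change_vec (shear_matrix i j (- 1)) d $ k) = (\<Sum>k\<in>UNIV. d $ k) + d $ j"
proof -
  have "(\<Sum>k\<in>UNIV. change_vec (shear_matrix i j (- 1)) d $ k) = (\<Sum>k\<in>UNIV. d $ k + (if k = i then d $ j else 0))"
    by (rule sum.cong) (simp_all add: sheared_generator)
  then show ?thesis by (simp add: sum.distrib)
qed

text \<open>The cone spanned by the simple roots grows: it still contains the old simple root \<open>\<alpha>\<^sub>j\<close>, and
  the new one was not in the cone before.\<close>

lemma card_transversal_roots_shear:
  assumes d0: "d $ i = 0" "d $ j = 0"
  shows "card (transversal_roots A d) < card (transversal_roots (gram A (shear_matrix i j 1)) d)"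
proof -
  let ?P = "change_vec (shear_matrix i j 1) :: int^'n \<Rightarrow> int^'n"
  let ?Q = "change_vec (shear_matrix i j (- 1)) :: int^'n \<Rightarrow> int^'n"
  have "change_vec (shear_matrix i j (- 1)) d = d" using d0 by (simp add: vec_eq_iff sheared_generator)
  then have fin: "finite (transversal_roots (gram A (shear_matrix i j 1)) d)"
    using finite_transversal_roots[OF admissible_shear] by simp
  have PQ: "?P (?Q x) = x" "?Q (?P x) = x" for x
    using ij by (simp_all add: shear_shear shear_shear'[of i j 1])
  have "?Q x \<in> transversal_roots (gram A (shear_matrix i j 1)) d" if "x \<in> transversal_roots A d" for x
  proof -
    have "d $ k * ?Q x $ k = d $ k * x $ k" for k
      using d0 by (simp add: change_vec_shear)
    then have "(\<Sum>k\<in>UNIV. d $ k * ?Q x $ k) = (\<Sum>k\<in>UNIV. d $ k * x $ k)" by (rule sum.cong[OF HOL.refl])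
    moreover have nonneg: "0 \<le> x $ k" for k
      using that by (simp add: transversal_roots_def)
    have "0 \<le> ?Q x $ k" for k
      using nonneg[of k] nonneg[of j] by (auto simp: change_vec_shear)
    ultimately show ?thesis
      using that by (simp add: transversal_roots_def form_gram PQ)
  qed
  moreover have "axis j 1 \<in> transversal_roots (gram A (shear_matrix i j 1)) d"
  proof -
    have "(\<Sum>k\<in>UNIV. d $ k * axis j 1 $ k) = 0"
      using d0 by (intro sum.neutral) (auto simp: axis_def)
    moreover have "form (gram A (shear_matrix i j 1)) (axis j 1) (axis j 1) = (2::int)"
      using intersection_matrix_shear by (simp add: form_axis intersection_matrix_def)
    ultimately show ?thesis by (auto simp: transversal_roots_def axis_def)
  qed
  moreover have "axis j 1 \<notin> ?Q ` transversal_roots A d"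
  proof
    assume "axis j 1 \<in> ?Q ` transversal_roots A d"
    then obtain x where x: "x \<in> transversal_roots A d" "axis j 1 = ?Q x" by auto
    have "x $ i = ?P (axis j 1) $ i" unfolding x(2) PQ ..
    also have "\<dots> = - 1" using ij by (simp add: change_vec_shear axis_def)
    finally show False using x(1) by (auto simp: transversal_roots_def dest!: spec[of _ i])
  qed
  ultimately have "?Q ` transversal_roots A d \<subset> transversal_roots (gram A (shear_matrix i j 1)) d" by blast
  then have "card (?Q ` transversal_roots A d) < card (transversal_roots (gram A (shear_matrix i j 1)) d)"
    by (rule psubset_card_mono[OF fin])
  moreover have "inj_on ?Q (transversal_roots A d)" by (metis PQ(1) inj_onI)
  ultimately show ?thesis by (simp add: card_image)
qed

end


text \<open>The reduction. If \<open>\<alpha>\<^sub>i\<close> and \<open>\<alpha>\<^sub>j\<close> have inner product \<open>1\<close>, then replacing \<open>\<alpha>\<^sub>j\<close> by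
  \<open>\<alpha>\<^sub>j - \<alpha>\<^sub>i\<close> adds \<open>d\<^sub>j\<close> to the sum of the coordinates of \<open>d\<close>. If this is impossible because \<open>d\<^sub>i\<close> and
  \<open>d\<^sub>j\<close> both vanish, then it increases the number of transversal roots instead. Both quantities are
  bounded because there are only finitely many admissible pairs.\<close>

lemma admissible_isomorphic_kac_moody:
  fixes A :: "int^'n^'n"
  assumes "admissible A d"
  shows "\<exists>B :: int^'n^'n. symmetric_generalized_cartan_matrix B \<and>
    lie_isomorphic (presented_lie_algebra (IM_relations A)) (kac_moody_algebra B)"
proof -
  define S where "S = {p :: (int^'n^'n) \<times> (int^'n). admissible (fst p) (snd p)}"
  define ht where "ht d = nat (\<Sum>k\<in>UNIV. d $ k)" for d :: "int^'n"
  define c where "c p = card (transversal_roots (fst p) (snd p))" for p :: "(int^'n^'n) \<times> (int^'n)"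
  define N where "N = (\<Sum>p\<in>S. c p)"
  \<comment> \<open>The factor \<open>N + 1\<close> makes an increase of the height outweigh any loss of transversal roots.\<close>
  define \<phi> where "\<phi> p = ht (snd p) * (N + 1) + c p" for p
  define K where "K = (\<Sum>p\<in>S. \<phi> p)"
  have fin: "finite S" unfolding S_def by (rule finite_admissible)
  have cN: "c p \<le> N" and \<phi>K: "\<phi> p \<le> K" if "p \<in> S" for p
    unfolding N_def K_def using fin that by (auto intro: member_le_sum)
  show ?thesis
    using assms
  proof (induction "K - \<phi> (A, d)" arbitrary: A d rule: less_induct)
    case less
    have A: "intersection_matrix A" using less.prems by (simp add: admissible_def)
    show ?case
    proof (cases "\<exists>i j. i \<noteq> j \<and> A $ i $ j > 0")
      case False
      then have B: "symmetric_generalized_cartan_matrix A"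
        using A by (auto simp: symmetric_generalized_cartan_matrix_def not_less)
      then show ?thesis
        using kac_moody.presented_IM_eq_kac_moody[OF kac_moody.intro[OF B]] lie_isomorphic_refl by metis
    next
      case True
      then obtain a b where ab: "a \<noteq> b" "A $ a $ b > 0" by blast
      obtain i j where ij: "i \<noteq> j" "A $ i $ j > 0" and dj: "0 < d $ j \<or> d $ i = 0 \<and> d $ j = 0"
      proof (cases "0 < d $ b \<or> d $ a = 0 \<and> d $ b = 0")
        case True
        then show ?thesis using that ab by blast
      next
        case False
        then have "0 < d $ a" using less.prems by (auto simp: admissible_def order_less_le)
        then show ?thesis using that[of b a] ab intersection_matrix_sym[OF A, of a b] by simp
      qed
      have "A $ i $ j = 1" by (rule admissible_positive_entry[OF less.prems ij])
      then have sh: "shear A i j 1" using A ij by (simp add: shear_def)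
      let ?A = "gram A (shear_matrix i j 1)" and ?d = "change_vec (shear_matrix i j (- 1)) d"
      have ad: "admissible ?A ?d" by (rule admissible_shear[OF less.prems sh])
      then have inS: "(A, d) \<in> S" "(?A, ?d) \<in> S" using less.prems by (simp_all add: S_def)
      have "\<phi> (A, d) < \<phi> (?A, ?d)"
        using dj
      proof
        assume dj: "0 < d $ j"
        have "0 \<le> (\<Sum>k\<in>UNIV. d $ k)" using less.prems by (auto simp: admissible_def intro: sum_nonneg)
        then have "ht d + 1 \<le> ht ?d"
          using sum_sheared_generator[OF less.prems sh] dj by (simp add: ht_def)
        then have "(ht d + 1) * (N + 1) \<le> ht ?d * (N + 1)" by (rule mult_le_mono1)
        then show ?thesis using cN[OF inS(1)] by (simp add: \<phi>_def)
      next
        assume d0: "d $ i = 0 \<and> d $ j = 0"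
        then have "?d = d" by (simp add: vec_eq_iff sheared_generator[OF less.prems sh])
        then show ?thesis
          using card_transversal_roots_shear[OF less.prems sh] d0 by (simp add: \<phi>_def c_def)
      qed
      then have "K - \<phi> (?A, ?d) < K - \<phi> (A, d)" using \<phi>K[OF inS(2)] by linarith
      from less.hyps[OF this ad] show ?thesis
        using IM_isomorphic_shear[OF sh] lie_isomorphic_trans by metis
    qed
  qed
qed

theorem corollary2p14:
  fixes A :: "int^'n^'n"
  assumes "intersection_matrix A"
    and "positive_semidefinite A"
    and "corank A \<le> 1"
  shows "\<exists>B :: int^'n^'n. symmetric_generalized_cartan_matrix B \<and>
           lie_isomorphic (IM A) (kac_moody_algebra B)"
proof -
  obtain d where d: "radical_generator A d"
    using radical_generator_exists[OF assms(1,3)] by blast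
  let ?N = "{k. d $ k < 0}"
  obtain B :: "int^'n^'n" where "symmetric_generalized_cartan_matrix B"
    and "lie_isomorphic (presented_lie_algebra (IM_relations (gram A (flip_matrix ?N)))) (kac_moody_algebra B)"
    using admissible_isomorphic_kac_moody[OF admissible_flip[OF assms(1,2) d]] by blast
  then show ?thesis
    using IM_isomorphic_presented[of A] IM_isomorphic_flip[OF assms(1), of ?N] lie_isomorphic_trans
    by metis
qed

end
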